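(* Let $\mathbb{K}$ be a field of characteristic $0$ and let $0\le d\le N$ be integers. Then the regular Grassmannian $\mathrm{RGr}_{\mathbb{K}}(d,N)$ is a projective variety: it is the zero set of the ideal $I_{\mathrm{RGr}(d,N)}=I_{\mathrm{Gr}(d,N)}+R_{d,N}$ in $\Lambda^d\mathbb{K}^N/\mathbb{K}^*$. In particular, the regular Grassmannian is a variety that is defined by homogeneous quadratic polynomials and monomials of degree $6$.
   Context: $\Lambda^d\mathbb{K}^N$ is the $d$-th exterior power with basis $e_{i_1}\wedge\dots\wedge e_{i_d}$, $1\le i_1<\dots<i_d\le N$; $\Lambda^d\mathbb{K}^N/\mathbb{K}^*$ denotes the corresponding projective space of dimension $\binom Nd-1$. For $i_1,\dots,i_d\in[N]$, the bracket $[i_1\dots i_d]\in(\Lambda^d\mathbb{K}^N)^*$ is the coordinate function of $e_{i_1}\wedge\dots\wedge e_{i_d}$ if $i_1<\dots<i_d$, and is extended alternatingly to all index sequences (zero if two indices coincide, sign change under transpositions). The bracket ring $\mathbb{K}[\,[i_1\dots i_d]:1\le i_1<\dots<i_d\le N]$ is the ring of polynomial functions on $\Lambda^d\mathbb{K}^N$. The Grassmannian $\mathrm{Gr}_{\mathbb{K}}(d,N)\subseteq\Lambda^d\mathbb{K}^N/\mathbb{K}^*$ is the set of classes of non-zero decomposable tensors $v_1\wedge\dots\wedge v_d$; equivalently of $(d\times N)$-matrices $X$ of full rank $d$ (with rows $v_1,\dots,v_d$) modulo left multiplication by $\mathrm{GL}(d,\mathbb{K})$. The matroid represented by $X$ (on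 ground set $[N]$, by linear rank of columns) depends only on the class $\bar X$. The regular Grassmannian is $$\mathrm{RGr}_{\mathbb{K}}(d,N)=\{\bar X\in\mathrm{Gr}_{\mathbb{K}}(d,N): X\text{ represents a regular matroid}\}.$$ A matroid is regular if it can be represented over every field, equivalently by a totally unimodular matrix. $I_{\mathrm{Gr}(d,N)}$ is the Grassmann–Plücker ideal, generated by the quadratic polynomials $$[b_1b_2\dots b_d][b_1'b_2'\dots b_d']-\sum_{i=1}^d[b_i'b_2\dots b_d][b_1'\dots b_{i-1}'b_1b_{i+1}'\dots b_d'],\quad b_j,b_j'\in[N].$$ $R_{d,N}$ is the ideal generated by the monomials $$\prod_{\{\alpha,\beta\}\in\binom{\{p_1,\dots,p_4\}}{2}}[b_1\dots b_{d-2}\,\alpha\,\beta]$$ for all choices of $d+2$ distinct elements $b_1,\dots,b_{d-2},p_1,p_2,p_3,p_4$ of $[N]$. If there are no such choices (for example if $d<2$), $R_{d,N}=0$. *)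

theory Defs
  imports
    "HOL-Library.Poly_Mapping"
    "Jordan_Normal_Form.DL_Submatrix"
    "Jordan_Normal_Form.VS_Connect"
begin

text \<open>
  The ground set [N] is \<open>{..<N}\<close>. A vector of the \<open>d\<close>-th exterior power of \<open>K^N\<close> is given by its
  coordinates: the basis element \<open>e_{i_1} \<and> \<dots> \<and> e_{i_d}\<close> with \<open>i_1 < \<dots> < i_d\<close> is
  indexed by the set \<open>{i_1, \<dots>, i_d}\<close>, and coordinates at all other sets are 0.
\<close>

definition basis_indices :: "nat \<Rightarrow> nat \<Rightarrow> nat set set" where
  "basis_indices d N = {S. S \<subseteq> {..<N} \<and> card S = d}"

definition exterior_power :: "nat \<Rightarrow> nat \<Rightarrow> (nat set \<Rightarrow> 'a::zero) set" where
  "exterior_power d N = {x. \<forall>S. S \<notin> basis_indices d N \<longrightarrow> x S = 0}"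

definition scaling_rel :: "nat \<Rightarrow> nat \<Rightarrow> ((nat set \<Rightarrow> 'a::field) \<times> (nat set \<Rightarrow> 'a)) set" where
  "scaling_rel d N = {(x, y). x \<in> exterior_power d N - {\<lambda>_. 0} \<and> y \<in> exterior_power d N - {\<lambda>_. 0}
      \<and> (\<exists>c. c \<noteq> 0 \<and> y = (\<lambda>S. c * x S))}"

definition proj_exterior_power :: "nat \<Rightarrow> nat \<Rightarrow> (nat set \<Rightarrow> 'a::field) set set" where
  "proj_exterior_power d N = (exterior_power d N - {\<lambda>_. 0}) // scaling_rel d N"


subsection \<open>The regular Grassmannian\<close>

text \<open>
  The coordinates of \<open>v_1 \<and> \<dots> \<and> v_d\<close>, where the \<open>v_i\<close> are the rows of \<open>X\<close>, are the maximal
  minors of \<open>X\<close> (for \<open>d = 0\<close> the determinant of the empty matrix is 1).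
\<close>

definition wedge_rows :: "nat \<Rightarrow> nat \<Rightarrow> 'a::field mat \<Rightarrow> nat set \<Rightarrow> 'a" where
  "wedge_rows d N X S = (if S \<in> basis_indices d N then det (submatrix X UNIV S) else 0)"

definition grassmannian :: "nat \<Rightarrow> nat \<Rightarrow> (nat set \<Rightarrow> 'a::field) set set" where
  "grassmannian d N =
    {scaling_rel d N `` {wedge_rows d N X} | X. X \<in> carrier_mat d N \<and> wedge_rows d N X \<noteq> (\<lambda>_. 0)}"

text \<open>
  Matroids are given by their independent sets. Independence is that of the family of columns
  indexed by \<open>J\<close>, so equal columns are parallel elements. \<open>F\<close> is a ring record, so that
  one can quantify over all fields below.
\<close>

definition column_matroid :: "('b, 'm) ring_scheme \<Rightarrow> 'b mat \<Rightarrow> nat set set" where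
  "column_matroid F A =
    {J. J \<subseteq> {..<dim_col A} \<and>
        (\<forall>c \<in> J \<rightarrow> carrier F.
          (\<forall>i < dim_row A. (\<Oplus>\<^bsub>F\<^esub>j\<in>J. A $$ (i, j) \<otimes>\<^bsub>F\<^esub> c j) = \<zero>\<^bsub>F\<^esub>) \<longrightarrow> (\<forall>j\<in>J. c j = \<zero>\<^bsub>F\<^esub>))}"

definition representable_over :: "'b ring \<Rightarrow> nat \<Rightarrow> nat set set \<Rightarrow> bool" where
  "representable_over F N I \<longleftrightarrow>
    (\<exists>r. \<exists>A \<in> carrier_mat r N. elements_mat A \<subseteq> carrier F \<and> column_matroid F A = I)"

text \<open>
  A formula of HOL cannot quantify over all types, so regularity is relative to a type \<open>'u\<close>
  serving as a universe: all fields whose carrier is a subset of \<open>'u\<close> are considered.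
  For every infinite \<open>'u\<close> this is equivalent to representability over all fields whatsoever: only
  finitely many entries occur in a representation, and every countable field has a copy in \<open>'u\<close>.
\<close>

definition regular_matroid :: "'u itself \<Rightarrow> nat \<Rightarrow> nat set set \<Rightarrow> bool" where
  "regular_matroid _ N I \<longleftrightarrow> (\<forall>F :: 'u ring. Ring.field F \<longrightarrow> representable_over F N I)"

definition regular_grassmannian ::
    "'u itself \<Rightarrow> nat \<Rightarrow> nat \<Rightarrow> (nat set \<Rightarrow> 'a::field) set set" where
  "regular_grassmannian U d N =
    {P \<in> grassmannian d N. \<exists>X \<in> carrier_mat d N. wedge_rows d N X \<in> P \<and>
        regular_matroid U N (column_matroid class_ring X)}"


subsection \<open>The bracket ring and its ideals\<close>

text \<open>
  Polynomials whose variables are indexed by sets; the exponent of the variable \<open>S\<close> in a monomial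
  \<open>m\<close> is \<open>lookup m S\<close>.
\<close>

type_synonym 'a bracket_poly = "(nat set \<Rightarrow>\<^sub>0 nat) \<Rightarrow>\<^sub>0 'a"

definition bracket_ring :: "nat \<Rightarrow> nat \<Rightarrow> 'a::comm_ring_1 bracket_poly set" where
  "bracket_ring d N = {p. \<forall>m \<in> Poly_Mapping.keys p. Poly_Mapping.keys m \<subseteq> basis_indices d N}"

definition eval_poly :: "(nat set \<Rightarrow> 'a::comm_ring_1) \<Rightarrow> 'a bracket_poly \<Rightarrow> 'a" where
  "eval_poly x p =
    (\<Sum>m \<in> Poly_Mapping.keys p. Poly_Mapping.lookup p m *
      (\<Prod>S \<in> Poly_Mapping.keys m. x S ^ Poly_Mapping.lookup m S))"

definition homogeneous :: "nat \<Rightarrow> 'a::comm_ring_1 bracket_poly \<Rightarrow> bool" where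
  "homogeneous k p \<longleftrightarrow>
    (\<forall>m \<in> Poly_Mapping.keys p. (\<Sum>S \<in> Poly_Mapping.keys m. Poly_Mapping.lookup m S) = k)"

definition is_monomial :: "'a::comm_ring_1 bracket_poly \<Rightarrow> bool" where
  "is_monomial p \<longleftrightarrow> (\<exists>m. p = Poly_Mapping.single m 1)"

definition bracket_ideal :: "nat \<Rightarrow> nat \<Rightarrow> 'a::comm_ring_1 bracket_poly set \<Rightarrow> 'a bracket_poly set" where
  "bracket_ideal d N G =
    {\<Sum>g\<in>H. a g * g | a H. finite H \<and> H \<subseteq> G \<and> (\<forall>g\<in>H. a g \<in> bracket_ring d N)}"

definition zero_set :: "nat \<Rightarrow> nat \<Rightarrow> 'a::field bracket_poly set \<Rightarrow> (nat set \<Rightarrow> 'a) set set" where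
  "zero_set d N G = {P \<in> proj_exterior_power d N. \<forall>x\<in>P. \<forall>g\<in>G. eval_poly x g = 0}"

definition projective_variety :: "nat \<Rightarrow> nat \<Rightarrow> (nat set \<Rightarrow> 'a::field) set set \<Rightarrow> bool" where
  "projective_variety d N V \<longleftrightarrow>
    (\<exists>G \<subseteq> bracket_ring d N. (\<forall>g\<in>G. \<exists>k. homogeneous k g) \<and> V = zero_set d N G)"

text \<open>The sign is that of the permutation sorting the list, via its number of inversions.\<close>

definition bracket :: "nat list \<Rightarrow> 'a::comm_ring_1 bracket_poly" where
  "bracket B =
    (if distinct B
     then Poly_Mapping.single (Poly_Mapping.single (set B) 1)
       ((-1) ^ card {(i, j). i < j \<and> j < length B \<and> B ! j < B ! i})
     else 0)"

text \<open>
  The relations single out an entry \<open>b\<^sub>1\<close>, so there are none for \<open>d = 0\<close>, where the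
  Grassmannian is the whole one-point projective space.
\<close>

definition plucker_relations :: "nat \<Rightarrow> nat \<Rightarrow> 'a::comm_ring_1 bracket_poly set" where
  "plucker_relations d N =
    {bracket (b # B) * bracket B' - (\<Sum>i<d. bracket (B' ! i # B) * bracket (B'[i := b])) | b B B'.
      length (b # B) = d \<and> length B' = d \<and> set (b # B) \<subseteq> {..<N} \<and> set B' \<subseteq> {..<N}}"

definition plucker_ideal :: "nat \<Rightarrow> nat \<Rightarrow> 'a::comm_ring_1 bracket_poly set" where
  "plucker_ideal d N = bracket_ideal d N (plucker_relations d N)"

definition R_generators :: "nat \<Rightarrow> nat \<Rightarrow> 'a::comm_ring_1 bracket_poly set" where
  "R_generators d N =
    {\<Prod>(i, j) \<in> {(i, j). i < j \<and> j < 4}. bracket (B @ [p ! i, p ! j]) | B p.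
      length B + 2 = d \<and> length p = 4 \<and> distinct (B @ p) \<and> set (B @ p) \<subseteq> {..<N}}"

definition R_ideal :: "nat \<Rightarrow> nat \<Rightarrow> 'a::comm_ring_1 bracket_poly set" where
  "R_ideal d N = bracket_ideal d N (R_generators d N)"

definition regular_grassmannian_ideal :: "nat \<Rightarrow> nat \<Rightarrow> 'a::comm_ring_1 bracket_poly set" where
  "regular_grassmannian_ideal d N = {p + q | p q. p \<in> plucker_ideal d N \<and> q \<in> R_ideal d N}"

end

theory Submission
  imports Defs
begin

text \<open>
  Both inclusions between the regular Grassmannian and the zero set are proved on the level of
  matroids. A generator of \<open>R_ideal\<close> is indexed by \<open>d - 2\<close> columns \<open>B\<close> and four further columns. At
  the point given by a matrix it is non-zero exactly if any two of the four complete \<open>B\<close> to a basis,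
  so that contracting \<open>B\<close> leaves a four-point line \<open>U\<^sub>2\<^sub>,\<^sub>4\<close>.

  The relations of \<open>plucker_relations\<close> hold for the maximal minors of a matrix: expand the
  first minor along its first column and use that a matrix times its adjugate is the determinant
  (\<open>columns_det_exchange\<close>). Conversely, a solution of these relations with a non-zero coordinate
  \<open>T\<close> is determined by its values at \<open>T\<close> and at those index sets that differ from \<open>T\<close> in one
  element, since the relations trade elements outside \<open>T\<close> for elements of \<open>T\<close>; writing these values into a matrix
  whose columns at \<open>T\<close> are the unit vectors gives a matrix with the prescribed minors
  (\<open>decomposable_if_exchange\<close>).

  Regular matroids contain no four-point line because such a line does not exist over the field with
  two elements: two of its three-point circuits share two points, and over that field the sum of
  the circuit relations is a dependency between the other two points
  (\<open>two_element_no_four_point_line\<close>). Hence the generators of \<open>R_ideal\<close> vanish on the regular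
  Grassmannian.

  The main step is the converse: a matrix over a field of characteristic 0 whose matroid has no
  four-point line among its bases represents a regular matroid. Bring the matrix into the form of a
  tableau, in which some columns \<open>b 0, b 1, \<dots>\<close> are the unit vectors. That there is no four-point
  line means that in this tableau, and in all those reached from it by pivoting, every
  2 by 2 block without zeros is singular (\<open>stably_proportional_if_no_four_point_line\<close>). This makes it
  possible to rescale the columns so that all entries become 0, 1 or -1
  (\<open>exists_sign_rescaling\<close>): adding one column at a time, it has to be seen that two non-zero entries
  of the new column agree up to sign whenever their rows are linked by a path of non-zero entries
  in the earlier columns; a shortest such path of length at least 2 has no chords, and pivoting on
  its first link makes it shorter (\<open>linked_rows_equal_up_to_sign\<close>).

  Pivoting now never leaves the entries 0, 1 and -1, so the whole pivoting process can be copied to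
  any field \<open>F\<close> by reading these entries in \<open>F\<close>. Over each field, the independent sets are the subsets
  of the bases of the tableaux that are reached (\<open>column_matroid_sign_tableau\<close>), and this
  description does not mention the field. So the same matroid is represented over all fields.
\<close>

section \<open>Tableaux and pivoting\<close>

text \<open>
  The row operations that turn column \<open>f\<close> into the unit vector of row \<open>r\<close>.
\<close>

definition pivot :: "nat \<Rightarrow> nat \<Rightarrow> (nat \<Rightarrow> nat \<Rightarrow> 'a::field) \<Rightarrow> nat \<Rightarrow> nat \<Rightarrow> 'a" where
  "pivot r f A i e = (if i = r then A r e / A r f else A i e - A i f * A r e / A r f)"

text \<open>
  The function \<open>b\<close> records which columns are the unit vectors; it only has this meaning for tableaux,
  but keeping it next to the matrix lets one follow the bases of the matroid along a sequence of pivots.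
\<close>

inductive reaches :: "nat \<Rightarrow> nat \<Rightarrow> (nat \<Rightarrow> nat \<Rightarrow> 'a::field) \<Rightarrow> (nat \<Rightarrow> nat) \<Rightarrow>
    (nat \<Rightarrow> nat \<Rightarrow> 'a) \<Rightarrow> (nat \<Rightarrow> nat) \<Rightarrow> bool" for d N A b where
  initial: "reaches d N A b A b"
| step: "reaches d N A b (pivot r f A') (b'(r := f))"
    if "reaches d N A b A' b'" "r < d" "f < N" "A' r f \<noteq> 0"

lemma reaches_trans:
  assumes "reaches d N A' b' A'' b''" "reaches d N A b A' b'"
  shows "reaches d N A b A'' b''"
  using assms by (induction rule: reaches.induct) (auto intro: reaches.step)

lemma reaches_pivot: "r < d \<Longrightarrow> f < N \<Longrightarrow> A r f \<noteq> 0 \<Longrightarrow> reaches d N A b (pivot r f A) (b(r := f))"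
  by (rule reaches.step[OF reaches.initial])

definition is_tableau :: "nat \<Rightarrow> nat \<Rightarrow> (nat \<Rightarrow> nat \<Rightarrow> 'a::field) \<Rightarrow> (nat \<Rightarrow> nat) \<Rightarrow> bool" where
  "is_tableau d N A b \<longleftrightarrow> (\<forall>k<d. b k < N \<and> (\<forall>i<d. A i (b k) = (if i = k then 1 else 0)))"

lemma is_tableau_basis_less: "is_tableau d N A b \<Longrightarrow> k < d \<Longrightarrow> b k < N"
  and is_tableau_unit: "is_tableau d N A b \<Longrightarrow> k < d \<Longrightarrow> i < d \<Longrightarrow> A i (b k) = (if i = k then 1 else 0)"
  by (auto simp: is_tableau_def)

lemma is_tableau_pivot:
  assumes "is_tableau d N A b" "r < d" "f < N" "A r f \<noteq> 0"
  shows "is_tableau d N (pivot r f A) (b(r := f))"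
  using assms by (auto simp: is_tableau_def pivot_def)

lemma is_tableau_reaches:
  assumes "reaches d N A b A' b'" "is_tableau d N A b"
  shows "is_tableau d N A' b'"
  using assms by (induction rule: reaches.induct) (auto intro: is_tableau_pivot)

lemma is_tableau_inj: "is_tableau d N A b \<Longrightarrow> inj_on b {..<d}"
  by (rule inj_onI) (metis is_tableau_unit lessThan_iff zero_neq_one)

text \<open>
  Every 2 by 2 block without zeros is singular. Its invariance under pivoting is not automatic and is
  therefore built into \<open>stably_proportional\<close> below, which holds if the matroid of a tableau has no
  four-point line.
\<close>

definition proportional :: "nat \<Rightarrow> nat \<Rightarrow> (nat \<Rightarrow> nat \<Rightarrow> 'a::field) \<Rightarrow> bool" where
  "proportional d N A \<longleftrightarrow> (\<forall>i<d. \<forall>k<d. \<forall>e<N. \<forall>f<N. i \<noteq> k \<longrightarrow>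
     A i e \<noteq> 0 \<longrightarrow> A i f \<noteq> 0 \<longrightarrow> A k e \<noteq> 0 \<longrightarrow> A k f \<noteq> 0 \<longrightarrow> A i e * A k f = A i f * A k e)"

definition stably_proportional :: "nat \<Rightarrow> nat \<Rightarrow> (nat \<Rightarrow> nat \<Rightarrow> 'a::field) \<Rightarrow> (nat \<Rightarrow> nat) \<Rightarrow> bool" where
  "stably_proportional d N A b \<longleftrightarrow> (\<forall>A' b'. reaches d N A b A' b' \<longrightarrow> proportional d N A')"

lemma stably_proportional_reaches:
  "stably_proportional d N A b \<Longrightarrow> reaches d N A b A' b' \<Longrightarrow> stably_proportional d N A' b'"
  unfolding stably_proportional_def using reaches_trans by blast

lemma stably_proportionalD: "stably_proportional d N A b \<Longrightarrow> proportional d N A"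
  unfolding stably_proportional_def using reaches.initial by blast

lemma proportionalD:
  assumes "proportional d N A" "i < d" "k < d" "e < N" "f < N"
    "A i e \<noteq> 0" "A i f \<noteq> 0" "A k e \<noteq> 0" "A k f \<noteq> 0"
  shows "A i e * A k f = A i f * A k e"
  using assms unfolding proportional_def by (cases "i = k") (auto simp: mult.commute)

section \<open>Rescaling a tableau to entries 0, 1 and -1\<close>

definition signs_on :: "nat set \<Rightarrow> nat \<Rightarrow> (nat \<Rightarrow> nat \<Rightarrow> 'a::field) \<Rightarrow> bool" where
  "signs_on C d A \<longleftrightarrow> (\<forall>i<d. \<forall>e\<in>C. A i e \<in> {0, 1, -1})"

text \<open>
  A new entry has the form \<open>a - b * c / p\<close> with \<open>a\<close>, \<open>b\<close>, \<open>c\<close>, \<open>p\<close> among 0, 1 and -1. It could only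
  be 2 or -2 if all four are non-zero, but then the block that they form is singular and the entry
  is 0.
\<close>

lemma signs_on_pivot:
  assumes "signs_on C d A" "proportional d N A" "C \<subseteq> {..<N}" "r < d" "f \<in> C" "A r f \<noteq> 0"
  shows "signs_on C d (pivot r f A)"
  unfolding signs_on_def
proof (intro allI impI ballI)
  fix i e assume i: "i < d" and e: "e \<in> C"
  have s: "A i e \<in> {0,1,-1}" "A i f \<in> {0,1,-1}" "A r e \<in> {0,1,-1}" "A r f \<in> {0,1,-1}"
    using assms i e unfolding signs_on_def by blast+
  have "A i e * A r f = A i f * A r e"
    if "A i e \<noteq> 0" "A i f \<noteq> 0" "A r e \<noteq> 0"
    by (rule proportionalD[OF assms(2)]) (use that assms i e in auto)
  then show "pivot r f A i e \<in> {0, 1, -1}"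
    using s assms(6) by (auto simp: pivot_def)
qed

text \<open>
  Paths in this relation are paths in the bipartite graph whose edges are the non-zero entries in
  the columns of \<open>C\<close>, with only the rows written down.
\<close>

definition linked_rows :: "nat set \<Rightarrow> nat \<Rightarrow> (nat \<Rightarrow> nat \<Rightarrow> 'a::field) \<Rightarrow> (nat \<times> nat) set" where
  "linked_rows C d A = {(i, k). i < d \<and> k < d \<and> (\<exists>f\<in>C. A i f \<noteq> 0 \<and> A k f \<noteq> 0)}"

lemma relpow_segment:
  assumes "\<And>j. j < n \<Longrightarrow> (p j, p (Suc j)) \<in> R" "a \<le> c" "c \<le> n"
  shows "(p a, p c) \<in> R ^^ (c - a)"
  using assms(2,3)
proof (induction c)
  case (Suc c)
  show ?case
  proof (cases "a = Suc c")
    case False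
    then have "(p a, p c) \<in> R ^^ (c - a)" "Suc c - a = Suc (c - a)" using Suc by auto
    with assms(1)[of c] Suc.prems show ?thesis by (auto intro: relpow_Suc_I)
  qed auto
qed auto

text \<open>
  Here \<open>e\<close> is a further column, whose entries are compared along a path through the columns of \<open>C\<close>.
  For a path of length 1 the comparison is the singularity of one 2 by 2 block. A longer path is
  either split at an inner row where column \<open>e\<close> is non-zero, or shortened by a pivot. The pivot changes
  the tableau, which is why the induction hypothesis ranges over all of them.
\<close>

lemma linked_rows_equal_up_to_sign:
  assumes "C \<subseteq> {..<N}" "e < N"
  shows "stably_proportional d N A b \<Longrightarrow> signs_on C d A \<Longrightarrow>
    (i, k) \<in> linked_rows C d A ^^ n \<Longrightarrow> A i e \<noteq> 0 \<Longrightarrow> A k e \<noteq> 0 \<Longrightarrow>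
    A i e = A k e \<or> A i e = - A k e"
proof (induction n arbitrary: A b i k rule: less_induct)
  case (less n)
  note IH = less.IH and sp = less.prems(1) and sg = less.prems(2)
  have pr: "proportional d N A" using sp by (rule stably_proportionalD)
  let ?E = "linked_rows C d A"
  show ?case
  proof (cases "\<exists>m<n. (i, k) \<in> ?E ^^ m")
    case True
    with IH sp sg less.prems show ?thesis by blast
  next
    case shortest: False
    obtain p where p: "p 0 = i" "p n = k" "\<And>j. j < n \<Longrightarrow> (p j, p (Suc j)) \<in> ?E"
      using less.prems(3) unfolding relpow_fun_conv by auto
    obtain g where g: "\<And>j. j < n \<Longrightarrow> g j \<in> C \<and> A (p j) (g j) \<noteq> 0 \<and> A (p (Suc j)) (g j) \<noteq> 0"
      using p(3) unfolding linked_rows_def by simp metis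
    have pd: "p j < d" if "j \<le> n" "0 < n" for j
      using p(3)[of j] p(3)[of "j - 1"] that unfolding linked_rows_def by (cases "j = n") auto
    consider "n = 0" | "n = 1" | "n \<ge> 2" by linarith
    then show ?thesis
    proof cases
      case 1
      then show ?thesis using p by simp
    next
      case 2
      have gC: "g 0 \<in> C" "A i (g 0) \<noteq> 0" "A k (g 0) \<noteq> 0" using g[of 0] 2 p by auto
      have ik: "i < d" "k < d" using pd[of 0] pd[of 1] 2 p by auto
      have "A i e * A k (g 0) = A i (g 0) * A k e"
        by (rule proportionalD[OF pr]) (use gC ik assms less.prems in auto)
      moreover have "A i (g 0) \<in> {1,-1}" "A k (g 0) \<in> {1,-1}"
        using sg gC ik unfolding signs_on_def by blast+
      ultimately show ?thesis by (auto; metis minus_minus)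
    next
      case n: 3
      show ?thesis
      proof (cases "A (p 1) e = 0")
        case False
        have "(p 0, p 1) \<in> ?E ^^ (1 - 0)" "(p 1, p n) \<in> ?E ^^ (n - 1)"
          by (rule relpow_segment[of n]; use p n in simp)+
        then have "A i e = A (p 1) e \<or> A i e = - A (p 1) e"
          "A (p 1) e = A k e \<or> A (p 1) e = - A k e"
          using IH[of 1, OF _ sp sg, of i "p 1"] IH[of "n - 1", OF _ sp sg, of "p 1" k] p n less.prems False
          by auto
        then show ?thesis by auto
      next
        case y1: True
        \<comment> \<open>The path may be taken to be a shortest one, hence without chords: a shortcut from \<open>p a\<close> to \<open>p c\<close>
            in fewer steps would give a shorter path.\<close>
        have jump: "(i, k) \<in> ?E ^^ (a + m + (n - c))"
          if "(p a, p c) \<in> ?E ^^ m" "a \<le> n" "c \<le> n" for a c m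
        proof -
          have "(p 0, p a) \<in> ?E ^^ (a - 0)" "(p c, p n) \<in> ?E ^^ (n - c)"
            by (rule relpow_segment[of n]; use p n that in simp)+
          then have "(p 0, p n) \<in> ?E ^^ a O (?E ^^ m O ?E ^^ (n - c))" using that(1) by auto
          then show ?thesis using p by (simp add: relpow_add O_assoc)
        qed
        have chord1: "A (p a) (g l) = 0" if "a < l" "l < n" for a l
        proof (rule ccontr)
          assume "A (p a) (g l) \<noteq> 0"
          then have "(p a, p (Suc l)) \<in> ?E ^^ 1"
            using g[OF that(2)] pd[of a] pd[of "Suc l"] that unfolding linked_rows_def by auto
          from jump[OF this] that have "(i, k) \<in> ?E ^^ (a + 1 + (n - Suc l))" by simp
          moreover have "a + 1 + (n - Suc l) < n" using that by simp
          ultimately show False using shortest by blast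
        qed
        have chord2: "A (p a) (g l) = 0" if "Suc l < a" "a \<le> n" for a l
        proof (rule ccontr)
          assume "A (p a) (g l) \<noteq> 0"
          then have "(p l, p a) \<in> ?E ^^ 1"
            using g[of l] pd[of a] pd[of l] that unfolding linked_rows_def by auto
          from jump[OF this] that have "(i, k) \<in> ?E ^^ (l + 1 + (n - a))" by simp
          moreover have "l + 1 + (n - a) < n" using that by simp
          ultimately show False using shortest by blast
        qed
        have p01: "p 0 \<noteq> p 1"
        proof
          assume "p 0 = p 1"
          then have "(p 0, p 1) \<in> ?E ^^ 0" by simp
          from jump[OF this] n have "(i, k) \<in> ?E ^^ (0 + 0 + (n - 1))" by simp
          moreover have "0 + 0 + (n - 1) < n" using n by simp
          ultimately show False using shortest by blast
        qed
        have g0: "g 0 \<in> C" "A (p 0) (g 0) \<noteq> 0" "A (p 1) (g 0) \<noteq> 0" using g[of 0] n by auto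
        have g1: "g 1 \<in> C" "A (p 1) (g 1) \<noteq> 0" "A (p 2) (g 1) \<noteq> 0" using g[of 1] n by (auto simp: numeral_2_eq_2)
        have pj1: "p j \<noteq> p 1" if "2 \<le> j" "j \<le> n" for j
          using chord2[of 0 j] that g0 by auto
        \<comment> \<open>Pivoting on the first link removes row \<open>p 1\<close> from the path. Because there are no chords, the only
            entry on the path that changes is the one in row \<open>p 0\<close> and column \<open>g 1\<close>, which becomes
            non-zero and links \<open>p 0\<close> directly to \<open>p 2\<close>.\<close>
        let ?A = "pivot (p 1) (g 0) A"
        have keep: "?A (p j) h = A (p j) h" if "2 \<le> j" "j \<le> n" for j h
          using chord2[of 0 j] pj1 that by (auto simp: pivot_def)
        have "?A (p 0) (g 1) \<noteq> 0"
          using p01 chord1[of 0 1] n g0 g1 by (auto simp: pivot_def)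
        moreover have "?A (p 2) (g 1) \<noteq> 0" using keep[of 2] n g1 by auto
        ultimately have e1: "(p 0, p 2) \<in> linked_rows C d ?A"
          using pd n g1(1) unfolding linked_rows_def by auto
        have e2: "(p j, p (Suc j)) \<in> linked_rows C d ?A" if "2 \<le> j" "j < n" for j
          using keep g[of j] pd n that unfolding linked_rows_def by auto
        define q where "q = (\<lambda>j. if j = 0 then p 0 else p (Suc j))"
        have "(q j, q (Suc j)) \<in> linked_rows C d ?A" if "j < n - 1" for j
          using that e1 e2[of "Suc j"] by (auto simp: q_def numeral_2_eq_2)
        then have "(q 0, q (n - 1)) \<in> linked_rows C d ?A ^^ (n - 1 - 0)"
          by (intro relpow_segment[of "n - 1"]) auto
        then have path: "(i, k) \<in> linked_rows C d ?A ^^ (n - 1)" using n p by (auto simp: q_def)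
        have y: "?A i e = A i e" "?A k e = A k e"
          using p01 p(1) y1 pj1[of n] n p(2) by (auto simp: pivot_def)
        have "stably_proportional d N ?A (b(p 1 := g 0))"
          by (rule stably_proportional_reaches[OF sp reaches_pivot]) (use pd n g0 assms in auto)
        moreover have "signs_on C d ?A"
          by (rule signs_on_pivot[OF sg pr assms(1)]) (use pd n g0 in auto)
        ultimately show ?thesis using IH[of "n - 1", OF _ _ _ path] n less.prems y by auto
      qed
    qed
  qed
qed

text \<open>
  Column \<open>e\<close> is multiplied by \<open>t e\<close>, and each row is divided by the factor of its own basis
  column, so that the basis columns remain unit vectors. This choice commutes with pivoting.
\<close>

definition rescale :: "(nat \<Rightarrow> 'a::field) \<Rightarrow> (nat \<Rightarrow> nat) \<Rightarrow> (nat \<Rightarrow> nat \<Rightarrow> 'a) \<Rightarrow> nat \<Rightarrow> nat \<Rightarrow> 'a" where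
  "rescale t b A i e = A i e * t e / t (b i)"

lemma rescale_pivot:
  assumes "\<And>e. t e \<noteq> 0" "A r f \<noteq> 0"
  shows "pivot r f (rescale t b A) = rescale t (b(r := f)) (pivot r f A)"
  using assms by (intro ext) (auto simp: pivot_def rescale_def field_simps)

lemma reaches_rescale:
  assumes t: "\<And>e. t e \<noteq> 0" and "reaches d N (rescale t b A) b A' b'"
  shows "\<exists>A''. A' = rescale t b' A'' \<and> reaches d N A b A'' b'"
  using assms(2)
proof (induction rule: reaches.induct)
  case initial
  then show ?case using reaches.initial by blast
next
  case (step A' b' r f)
  then obtain A'' where A'': "A' = rescale t b' A''" "reaches d N A b A'' b'" by blast
  have "A'' r f \<noteq> 0" using step A'' by (auto simp: rescale_def)
  with rescale_pivot[of t, OF t] reaches.step[OF A''(2) step(2,3)] A'' show ?case by blast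
qed

lemma proportional_rescale:
  assumes "\<And>e. t e \<noteq> 0" "proportional d N A"
  shows "proportional d N (rescale t b A)"
  using assms unfolding proportional_def by (simp add: rescale_def)

lemma stably_proportional_rescale:
  assumes t: "\<And>e. t e \<noteq> 0" and "stably_proportional d N A b"
  shows "stably_proportional d N (rescale t b A) b"
  unfolding stably_proportional_def
proof (intro allI impI)
  fix A' b' assume "reaches d N (rescale t b A) b A' b'"
  then obtain A'' where "A' = rescale t b' A''" "reaches d N A b A'' b'"
    using reaches_rescale[of t, OF t] by blast
  with assms(2) proportional_rescale[of t, OF t] show "proportional d N A'"
    unfolding stably_proportional_def by blast
qed

lemma is_tableau_rescale:
  assumes t: "\<And>e. t e \<noteq> 0" and "is_tableau d N A b"
  shows "is_tableau d N (rescale t b A) b"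
  using assms by (auto simp: is_tableau_def rescale_def)

text \<open>
  Suppose the columns of \<open>C\<close> are already scaled. Then the new column \<open>e\<close> keeps its entries and the
  rows are rescaled instead: each class of linked rows is divided by one of the entries that column \<open>e\<close>
  has in that class. All these entries agree up to sign, so the choice does not matter,
  and the columns of \<open>C\<close> can follow their rows since each of them meets only one class.
\<close>

lemma exists_sign_rescaling_on:
  assumes tab: "is_tableau d N A b" and sp: "stably_proportional d N A b"
    and "finite D" "D \<subseteq> {..<N}"
  shows "\<exists>t. (\<forall>e. t e \<noteq> 0) \<and> signs_on (b ` {..<d} \<union> D) d (rescale t b A)"
  using assms(3,4)
proof (induction D rule: finite_induct)
  case empty
  have "signs_on (b ` {..<d} \<union> {}) d (rescale (\<lambda>_. 1) b A)"
    using tab by (auto simp: signs_on_def rescale_def is_tableau_def)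
  then show ?case by (intro exI[of _ "\<lambda>_. 1"]) simp
next
  case (insert e D)
  define C where "C = b ` {..<d} \<union> D"
  obtain t where t: "\<And>e. t e \<noteq> 0" and sg: "signs_on C d (rescale t b A)"
    using insert unfolding C_def by auto
  have bC: "b i \<in> C" if "i < d" for i using that by (auto simp: C_def)
  have CN: "C \<subseteq> {..<N}" using insert tab by (auto simp: C_def is_tableau_def)
  show ?case
  proof (cases "e \<in> C")
    case True
    then have "b ` {..<d} \<union> insert e D = C" by (auto simp: C_def)
    with t sg show ?thesis by auto
  next
    case eC: False
    define A1 where "A1 = rescale t b A"
    note sg = sg[folded A1_def]
    have sp1: "stably_proportional d N A1 b"
      unfolding A1_def by (rule stably_proportional_rescale[OF t sp])
    have tab1: "is_tableau d N A1 b" unfolding A1_def by (rule is_tableau_rescale[OF t tab])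
    define L where "L = (linked_rows C d A1)\<^sup>*"
    have L_sym: "(k, i) \<in> L" if "(i, k) \<in> L" for i k
    proof -
      have "sym (linked_rows C d A1)" by (auto simp: sym_def linked_rows_def)
      then show ?thesis using sym_rtrancl that unfolding L_def sym_def by blast
    qed
    have L_trans: "(i, l) \<in> L" if "(i, k) \<in> L" "(k, l) \<in> L" for i k l
      using that unfolding L_def by (rule rtrancl_trans)
    have L_refl: "(i, i) \<in> L" for i unfolding L_def by simp
    have link: "(i, k) \<in> L" if "i < d" "k < d" "f \<in> C" "A1 i f \<noteq> 0" "A1 k f \<noteq> 0" for i k f
      unfolding L_def linked_rows_def using that by auto
    have pm: "A1 i e = A1 k e \<or> A1 i e = - A1 k e"
      if "(i, k) \<in> L" "A1 i e \<noteq> 0" "A1 k e \<noteq> 0" for i k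
    proof -
      obtain n where n: "(i, k) \<in> linked_rows C d A1 ^^ n"
        using \<open>(i, k) \<in> L\<close> unfolding L_def by (metis rtrancl_power)
      show ?thesis
        by (rule linked_rows_equal_up_to_sign[OF CN _ sp1 sg n that(2,3)]) (use insert in auto)
    qed
    \<comment> \<open>\<open>s i\<close> is the divisor of row \<open>i\<close>, and 1 if column \<open>e\<close> vanishes on its class.\<close>
    define P where "P = (\<lambda>i k. (i, k) \<in> L \<and> A1 k e \<noteq> 0)"
    define s where "s = (\<lambda>i. if Ex (P i) then A1 (Eps (P i)) e else 1)"
    have P_Eps: "P i (Eps (P i))" if "P i k" for i k using that by (rule someI)
    have s_nz: "s i \<noteq> 0" for i using P_Eps by (auto simp: s_def P_def)
    have s_pm: "s i = s k \<or> s i = - s k" if "(i, k) \<in> L" for i k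
    proof -
      have eq: "P i = P k" using that L_trans L_sym unfolding P_def by blast
      then show ?thesis by (auto simp: s_def)
    qed
    have s_e: "s i = A1 i e \<or> s i = - A1 i e" if "A1 i e \<noteq> 0" for i
    proof -
      have "P i i" using that L_refl by (auto simp: P_def)
      then have "P i (Eps (P i))" by (rule P_Eps)
      then show ?thesis using pm[of i "Eps (P i)"] that \<open>P i i\<close> by (auto simp: s_def P_def)
    qed
    \<comment> \<open>\<open>u f\<close> is the divisor of the rows that column \<open>f\<close> meets, determined up to sign.\<close>
    define Q where "Q = (\<lambda>f i. i < d \<and> A1 i f \<noteq> 0)"
    define u where "u = (\<lambda>f. if f \<in> C \<and> Ex (Q f) then s (Eps (Q f)) else 1)"
    have Q_Eps: "Q f (Eps (Q f))" if "Q f i" for f i using that by (rule someI)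
    have u_nz: "u f \<noteq> 0" for f using s_nz by (auto simp: u_def)
    have u_pm: "u f = s i \<or> u f = - s i" if "f \<in> C" "i < d" "A1 i f \<noteq> 0" for f i
    proof -
      have "Q f i" using that by (auto simp: Q_def)
      then have "Q f (Eps (Q f))" by (rule Q_Eps)
      then have "(Eps (Q f), i) \<in> L" using link that by (auto simp: Q_def)
      from s_pm[OF this] show ?thesis using \<open>Q f i\<close> that by (auto simp: u_def)
    qed
    have u_b: "u (b i) = s i" if "i < d" for i
    proof -
      have Qi: "Q (b i) k \<longleftrightarrow> k = i" for k
        using tab1 that by (auto simp: Q_def is_tableau_def split: if_splits)
      then have "Q (b i) = (\<lambda>k. k = i)" by auto
      then show ?thesis using bC[OF that] by (auto simp: u_def)
    qed
    have ue: "u e = 1" using eC by (simp add: u_def)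
    have "rescale u b A1 i f \<in> {0, 1, -1}" if i: "i < d" and f: "f \<in> insert e C" for i f
    proof (cases "A1 i f = 0")
      case True
      then show ?thesis by (simp add: rescale_def)
    next
      case nz: False
      show ?thesis
      proof (cases "f = e")
        case True
        then show ?thesis using s_e[of i] nz s_nz[of i] ue u_b[OF i] by (auto simp: rescale_def)
      next
        case False
        then have fC: "f \<in> C" using f by simp
        then have "A1 i f \<in> {1,-1}" using sg i nz unfolding signs_on_def by blast
        then show ?thesis using u_pm[OF fC i nz] s_nz[of i] u_b[OF i] by (auto simp: rescale_def)
      qed
    qed
    then have "signs_on (b ` {..<d} \<union> insert e D) d (rescale u b A1)"
      unfolding signs_on_def C_def by auto
    moreover have "rescale u b A1 = rescale (\<lambda>f. t f * u f) b A"
      by (intro ext) (simp add: A1_def rescale_def)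
    ultimately show ?thesis using t u_nz by (intro exI[of _ "\<lambda>f. t f * u f"]) auto
  qed
qed

lemma exists_sign_rescaling:
  assumes "is_tableau d N A b" "stably_proportional d N A b"
  obtains t where "\<And>e. t e \<noteq> 0" "signs_on {..<N} d (rescale t b A)"
proof -
  have "b ` {..<d} \<union> {..<N} = {..<N}" using assms(1) by (auto simp: is_tableau_def)
  with exists_sign_rescaling_on[OF assms, of "{..<N}"] that show ?thesis by auto
qed

lemma signs_on_reaches:
  assumes "reaches d N A b A' b'" "stably_proportional d N A b" "signs_on {..<N} d A"
  shows "signs_on {..<N} d A'"
  using assms
proof (induction rule: reaches.induct)
  case (step A' b' r f)
  have "proportional d N A'" using step stably_proportional_def by blast
  with step show ?case by (intro signs_on_pivot) auto
qed

text \<open>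
  In a non-singular block without zeros, with rows \<open>i\<close>, \<open>k\<close> and columns \<open>e\<close>, \<open>f\<close>, the points
  \<open>b i\<close>, \<open>b k\<close>, \<open>e\<close>, \<open>f\<close> form a four-point line over the other basis columns: one pivot exchanges one
  of \<open>b i\<close>, \<open>b k\<close> for one of \<open>e\<close>, \<open>f\<close>, and non-singularity allows a second pivot that exchanges both.
\<close>

lemma stably_proportional_if_no_four_point_line:
  assumes tab: "is_tableau d N A b"
    and bases: "\<And>A' b'. reaches d N A b A' b' \<Longrightarrow> b' ` {..<d} \<in> \<B>"
    and no_line: "\<And>B p. card B + 2 = d \<Longrightarrow> B \<subseteq> {..<N} \<Longrightarrow> p ` {..<4} \<subseteq> {..<N} - B \<Longrightarrow>
      inj_on p {..<4::nat} \<Longrightarrow> \<exists>i j. i < j \<and> j < 4 \<and> B \<union> {p i, p j} \<notin> \<B>"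
  shows "stably_proportional d N A b"
  unfolding stably_proportional_def
proof (intro allI impI)
  fix A' b' assume R: "reaches d N A b A' b'"
  have tab': "is_tableau d N A' b'" by (rule is_tableau_reaches[OF R tab])
  show "proportional d N A'"
    unfolding proportional_def
  proof (intro allI impI, rule ccontr)
    fix i k e f assume H: "i < d" "k < d" "e < N" "f < N" "i \<noteq> k" "A' i e \<noteq> 0" "A' i f \<noteq> 0"
      "A' k e \<noteq> 0" "A' k f \<noteq> 0" "A' i e * A' k f \<noteq> A' i f * A' k e"
    have piv: "(b'(r := h)) ` {..<d} \<in> \<B>" if "r < d" "h < N" "A' r h \<noteq> 0" for r h
      by (rule bases[OF reaches.step[OF R that]])
    \<comment> \<open>The second pivot position holds the determinant of the block divided by the first pivot.\<close>
    have R2: "reaches d N A b (pivot k e A') (b'(k := e))"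
      by (rule reaches.step[OF R]) (use H in auto)
    have "pivot k e A' i f \<noteq> 0"
      using H by (auto simp: pivot_def field_simps)
    from bases[OF reaches.step[OF R2 H(1,4) this]]
    have ef: "(b'(k := e, i := f)) ` {..<d} \<in> \<B>" .
    have nb: "h \<noteq> b' j" if "j < d" "A' i h \<noteq> 0" "A' k h \<noteq> 0" for h j
      using is_tableau_unit[OF tab' that(1)] that H by (metis)
    have inj: "b' j = b' l \<longleftrightarrow> j = l" if "j < d" "l < d" for j l
      using is_tableau_inj[OF tab'] that by (auto simp: inj_on_def)
    define B where "B = b' ` ({..<d} - {i, k})"
    have cB: "card B = card ({..<d} - {i, k})" unfolding B_def
      by (rule card_image) (use is_tableau_inj[OF tab'] in \<open>auto simp: inj_on_def\<close>)
    have d2: "card ({..<d} - {i, k}) = d - 2" using H by (simp add: card_Diff_subset)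
    have dge: "d \<ge> 2" using H by auto
    have ef_ne: "e \<noteq> f" using H by auto
    define p where "p = (\<lambda>n::nat. [b' i, b' k, e, f] ! n)"
    have p: "p 0 = b' i" "p 1 = b' k" "p 2 = e" "p 3 = f" by (auto simp: p_def)
    have lt4: "{..<4::nat} = {0,1,2,3}" by auto
    have nbe: "e \<noteq> b' j" "f \<noteq> b' j" "b' j \<noteq> e" "b' j \<noteq> f" if "j < d" for j using nb that H by auto
    have "inj_on p {..<4}"
      unfolding lt4 using p ef_ne nbe H inj by (auto simp: inj_on_def)
    moreover have "p ` {..<4} \<subseteq> {..<N} - B"
      unfolding lt4 B_def using p nbe H inj is_tableau_basis_less[OF tab'] by auto
    moreover have "B \<subseteq> {..<N}" unfolding B_def using is_tableau_basis_less[OF tab'] by auto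
    moreover have "card B + 2 = d" using cB d2 dge by simp
    ultimately obtain u v where uv: "u < v" "v < 4" "B \<union> {p u, p v} \<notin> \<B>" using no_line by blast
    have im: "(b'(k := x, i := y)) ` {..<d} = B \<union> {y, x}" for x y
    proof -
      have "{..<d} = ({..<d} - {i, k}) \<union> {i, k}" using H by auto
      then have "(b'(k := x, i := y)) ` {..<d} =
        (b'(k := x, i := y)) ` ({..<d} - {i, k}) \<union> (b'(k := x, i := y)) ` {i, k}"
        by (metis image_Un)
      also have "(b'(k := x, i := y)) ` ({..<d} - {i, k}) = B" unfolding B_def by (rule image_cong) auto
      also have "(b'(k := x, i := y)) ` {i, k} = {y, x}" using H by auto
      finally show ?thesis .
    qed
    have "B \<union> {b' i, b' k} \<in> \<B>" using bases[OF R] im[of "b' k" "b' i"] by simp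
    moreover have "B \<union> {b' i, e} \<in> \<B>" "B \<union> {b' i, f} \<in> \<B>"
      using piv[of k e] piv[of k f] im[of e "b' i"] im[of f "b' i"] H by (simp_all add: fun_upd_twist fun_upd_idem)
    moreover have "B \<union> {b' k, e} \<in> \<B>" "B \<union> {b' k, f} \<in> \<B>"
      using piv[of i e] piv[of i f] im[of "b' k" e] im[of "b' k" f] H by (simp_all add: insert_commute)
    moreover have "B \<union> {e, f} \<in> \<B>" using ef im[of e f] by (simp add: insert_commute)
    ultimately have all: "B \<union> {p 0, p 1} \<in> \<B>" "B \<union> {p 0, p 2} \<in> \<B>" "B \<union> {p 0, p 3} \<in> \<B>"
      "B \<union> {p 1, p 2} \<in> \<B>" "B \<union> {p 1, p 3} \<in> \<B>" "B \<union> {p 2, p 3} \<in> \<B>" unfolding p by auto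
    have "(u = 0 \<and> v = 1) \<or> (u = 0 \<and> v = 2) \<or> (u = 0 \<and> v = 3) \<or> (u = 1 \<and> v = 2) \<or> (u = 1 \<and> v = 3) \<or> (u = 2 \<and> v = 3)"
      using uv by auto
    with all uv(3) show False by auto
  qed
qed

section \<open>Tableaux of signs represent the same matroid over every field\<close>

text \<open>
  The copy in \<open>F\<close> of an entry 0, 1 or -1; other arguments do not occur.
\<close>

definition sign_in :: "('b, 'm) ring_scheme \<Rightarrow> 'a::field_char_0 \<Rightarrow> 'b" where
  "sign_in F z = (if z = 0 then \<zero>\<^bsub>F\<^esub> else if z = 1 then \<one>\<^bsub>F\<^esub> else \<ominus>\<^bsub>F\<^esub> \<one>\<^bsub>F\<^esub>)"

context abelian_monoid begin
lemmas finsum_mono_neutral_cong_right = add.finprod_mono_neutral_cong_right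
end

definition null_vector :: "('b, 'm) ring_scheme \<Rightarrow> nat \<Rightarrow> nat \<Rightarrow> (nat \<Rightarrow> nat \<Rightarrow> 'b) \<Rightarrow> (nat \<Rightarrow> 'b) \<Rightarrow> bool" where
  "null_vector F r N A c \<longleftrightarrow> (\<forall>i<r. (\<Oplus>\<^bsub>F\<^esub>j\<in>{..<N}. A i j \<otimes>\<^bsub>F\<^esub> c j) = \<zero>\<^bsub>F\<^esub>)"

text \<open>
  Extending coefficients by zero lets all linear relations run over the same index set, where they
  can be added and transported along row operations.
\<close>

lemma (in Ring.cring) column_matroid_iff_null_vectors:
  assumes A: "A \<in> carrier_mat r N" and elems: "elements_mat A \<subseteq> carrier R"
  shows "J \<in> column_matroid R A \<longleftrightarrow> J \<subseteq> {..<N} \<and>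
    (\<forall>c \<in> {..<N} \<rightarrow> carrier R. (\<forall>j\<in>{..<N} - J. c j = \<zero>) \<longrightarrow>
      null_vector R r N (\<lambda>i j. A $$ (i, j)) c \<longrightarrow> (\<forall>j<N. c j = \<zero>))"
    (is "_ \<longleftrightarrow> _ \<and> ?rhs")
proof (cases "J \<subseteq> {..<N}")
  case J: True
  have AF: "A $$ (i, j) \<in> carrier R" if "i < r" "j < N" for i j
    using elements_matI[OF A that HOL.refl] elems by blast
  have sum_eq: "(\<Oplus>j\<in>{..<N}. A $$ (i, j) \<otimes> c j) = (\<Oplus>j\<in>J. A $$ (i, j) \<otimes> c' j)"
    if "c \<in> {..<N} \<rightarrow> carrier R" "\<And>j. j \<in> {..<N} - J \<Longrightarrow> c j = \<zero>" "\<And>j. j \<in> J \<Longrightarrow> c j = c' j" "i < r"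
    for i c c'
    by (rule finsum_mono_neutral_cong_right) (use that J AF in auto)
  show ?thesis
  proof
    assume L: "J \<in> column_matroid R A"
    have ?rhs
    proof (intro ballI impI allI)
      fix c j assume c: "c \<in> {..<N} \<rightarrow> carrier R" "\<forall>j\<in>{..<N} - J. c j = \<zero>"
        and n: "null_vector R r N (\<lambda>i j. A $$ (i, j)) c" and j: "j < N"
      have "\<forall>i<dim_row A. (\<Oplus>j\<in>J. A $$ (i, j) \<otimes> c j) = \<zero>"
        using n sum_eq[of c c] c A unfolding null_vector_def by auto
      moreover have "c \<in> J \<rightarrow> carrier R" using c J by auto
      ultimately have "\<forall>j\<in>J. c j = \<zero>" using L unfolding column_matroid_def by blast
      with c j show "c j = \<zero>" by auto
    qed
    with J show "J \<subseteq> {..<N} \<and> ?rhs" by blast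
  next
    assume R: "J \<subseteq> {..<N} \<and> ?rhs"
    have "\<forall>j\<in>J. c j = \<zero>"
      if c: "c \<in> J \<rightarrow> carrier R" and n: "\<forall>i<dim_row A. (\<Oplus>j\<in>J. A $$ (i, j) \<otimes> c j) = \<zero>" for c
    proof -
      define c' where "c' = (\<lambda>j. if j \<in> J then c j else \<zero>)"
      have c': "c' \<in> {..<N} \<rightarrow> carrier R" "\<forall>j\<in>{..<N} - J. c' j = \<zero>" using c by (auto simp: c'_def)
      moreover have "null_vector R r N (\<lambda>i j. A $$ (i, j)) c'"
        using n sum_eq[of c' c] c' A unfolding null_vector_def by (auto simp: c'_def)
      ultimately have "\<forall>j<N. c' j = \<zero>" using R by blast
      then show ?thesis using J by (auto simp: c'_def split: if_splits)
    qed
    then show "J \<in> column_matroid R A" using J A unfolding column_matroid_def by auto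
  qed
qed (use A in \<open>auto simp: column_matroid_def\<close>)

context Ring.cring begin

lemma sign_in_closed [simp]: "sign_in R z \<in> carrier R" by (simp add: sign_in_def)

lemma sign_in_simps [simp]: "sign_in R 0 = \<zero>" "sign_in R 1 = \<one>" "sign_in R (- 1) = \<ominus> \<one>"
  by (simp_all add: sign_in_def)

lemma sign_in_mult:
  assumes "z \<in> {0, 1, -1}" "w \<in> {0, 1, -1}"
  shows "sign_in R (z * w) = sign_in R z \<otimes> sign_in R w"
  using assms by (auto simp: l_minus)

text \<open>
  Characteristic 0 of the source enters here: it excludes that 1 - (-1) or -1 - 1 is again
  one of 0, 1 and -1, so that all remaining cases hold in every ring.
\<close>

lemma sign_in_diff:
  assumes "z \<in> {0, 1, -1}" "w \<in> {0, 1, -1}" "z - w \<in> {0, 1, -1}"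
  shows "sign_in R (z - w) = sign_in R z \<oplus> \<ominus> sign_in R w"
proof -
  have two: "(1::'c) - (-1) \<notin> {0, 1, -1}" "(-1::'c) - 1 \<notin> {0, 1, -1}"
  proof -
    have "(of_nat 2::'c) \<noteq> of_nat 0" "(of_nat 2::'c) \<noteq> of_nat 1" "(of_nat 3::'c) \<noteq> of_nat 0"
      unfolding of_nat_eq_iff by simp_all
    then show "(1::'c) - (-1) \<notin> {0, 1, -1}" "(-1::'c) - 1 \<notin> {0, 1, -1}"
      by (auto simp: eq_neg_iff_add_eq_0 minus_equation_iff)
  qed
  then show ?thesis using assms by (auto simp: r_neg l_neg)
qed

lemma finsum_row_operation:
  assumes "u \<in> I \<rightarrow> carrier R" "v \<in> I \<rightarrow> carrier R" "c \<in> I \<rightarrow> carrier R" "k \<in> carrier R" "finite I"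
  shows "(\<Oplus>j\<in>I. (u j \<oplus> k \<otimes> v j) \<otimes> c j) = (\<Oplus>j\<in>I. u j \<otimes> c j) \<oplus> k \<otimes> (\<Oplus>j\<in>I. v j \<otimes> c j)"
proof -
  have "(\<Oplus>j\<in>I. (u j \<oplus> k \<otimes> v j) \<otimes> c j) = (\<Oplus>j\<in>I. u j \<otimes> c j \<oplus> k \<otimes> (v j \<otimes> c j))"
    by (rule finsum_cong') (use assms in \<open>auto simp: Pi_iff l_distr m_assoc\<close>)
  also have "\<dots> = (\<Oplus>j\<in>I. u j \<otimes> c j) \<oplus> (\<Oplus>j\<in>I. k \<otimes> (v j \<otimes> c j))"
    by (rule finsum_addf) (use assms in \<open>auto simp: Pi_iff\<close>)
  also have "(\<Oplus>j\<in>I. k \<otimes> (v j \<otimes> c j)) = k \<otimes> (\<Oplus>j\<in>I. v j \<otimes> c j)"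
    by (rule finsum_rdistr[symmetric]) (use assms in auto)
  finally show ?thesis .
qed

text \<open>
  Read in \<open>R\<close>, the pivot is still an invertible row operation, since the pivot entry is 1 or -1
  and therefore its own inverse.
\<close>

lemma null_vector_pivot:
  assumes c: "c \<in> {..<N} \<rightarrow> carrier R" and r: "r < d" and f: "f < N" and nz: "A r f \<noteq> 0"
    and sg: "signs_on {..<N} d A" and sg': "signs_on {..<N} d (pivot r f A)"
  shows "null_vector R d N (\<lambda>i j. sign_in R (pivot r f A i j)) c \<longleftrightarrow>
    null_vector R d N (\<lambda>i j. sign_in R (A i j)) c"
proof -
  let ?s = "sign_in R"
  let ?p = "A r f"
  define S where "S = (\<lambda>i. \<Oplus>j\<in>{..<N}. ?s (A i j) \<otimes> c j)"
  define S' where "S' = (\<lambda>i. \<Oplus>j\<in>{..<N}. ?s (pivot r f A i j) \<otimes> c j)"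
  have s01: "A i e \<in> {0, 1, -1}" "pivot r f A i e \<in> {0, 1, -1}" if "i < d" "e < N" for i e
    using sg sg' that unfolding signs_on_def by blast+
  have p1: "?p = 1 \<or> ?p = -1" using s01[OF r f] nz by auto
  have prod01: "z * w \<in> {0, 1, -1}" if "z \<in> {0, 1, -1}" "w \<in> {0, 1, -1}" for z w :: 'c
    using that by auto
  have Sc: "S i \<in> carrier R" "S' i \<in> carrier R" for i
    unfolding S_def S'_def by (rule finsum_closed; use c in \<open>auto simp: Pi_iff\<close>)+
  have Sr: "S' r = ?s ?p \<otimes> S r"
  proof -
    have "S' r = (\<Oplus>j\<in>{..<N}. (\<zero> \<oplus> ?s ?p \<otimes> ?s (A r j)) \<otimes> c j)"
      unfolding S'_def
    proof (rule finsum_cong')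
      fix j assume "j \<in> {..<N}"
      then have "pivot r f A r j = ?p * A r j" using p1 by (auto simp: pivot_def)
      then show "?s (pivot r f A r j) \<otimes> c j = (\<zero> \<oplus> ?s ?p \<otimes> ?s (A r j)) \<otimes> c j"
        using sign_in_mult[OF s01(1)[OF r f] s01(1)[OF r, of j]] \<open>j \<in> _\<close> by simp
    qed (use c in auto)
    also have "\<dots> = (\<Oplus>j\<in>{..<N}. \<zero> \<otimes> c j) \<oplus> ?s ?p \<otimes> S r"
      unfolding S_def by (rule finsum_row_operation) (use c in auto)
    also have "(\<Oplus>j\<in>{..<N}. \<zero> \<otimes> c j) = \<zero>"
      by (subst finsum_cong'[of _ "{..<N}" "\<lambda>_. \<zero>"]) (use c in \<open>auto simp: Pi_iff\<close>)
    finally show ?thesis using Sc by simp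
  qed
  have Si: "S' i = S i \<oplus> \<ominus> ?s (A i f * ?p) \<otimes> S r" if i: "i < d" "i \<noteq> r" for i
  proof -
    have "S' i = (\<Oplus>j\<in>{..<N}. (?s (A i j) \<oplus> \<ominus> ?s (A i f * ?p) \<otimes> ?s (A r j)) \<otimes> c j)"
      unfolding S'_def
    proof (rule finsum_cong')
      fix j assume j: "j \<in> {..<N}"
      then have eq: "pivot r f A i j = A i j - (A i f * ?p) * A r j" using p1 i by (auto simp: pivot_def)
      have q: "A i f * ?p \<in> {0,1,-1}" by (intro prod01 s01 i r f)
      have q': "A i f * ?p * A r j \<in> {0,1,-1}" by (intro prod01[OF q] s01) (use r j in auto)
      have "?s (pivot r f A i j) = ?s (A i j) \<oplus> \<ominus> ?s (A i f * ?p * A r j)"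
        unfolding eq by (rule sign_in_diff[OF _ q']) (use s01[of i j] i j eq in auto)
      also have "?s (A i f * ?p * A r j) = ?s (A i f * ?p) \<otimes> ?s (A r j)"
        by (rule sign_in_mult[OF q]) (use s01 r j in auto)
      finally show "?s (pivot r f A i j) \<otimes> c j = (?s (A i j) \<oplus> \<ominus> ?s (A i f * ?p) \<otimes> ?s (A r j)) \<otimes> c j"
        by (simp add: l_minus)
    qed (use c in auto)
    also have "\<dots> = S i \<oplus> \<ominus> ?s (A i f * ?p) \<otimes> S r"
      unfolding S_def by (rule finsum_row_operation) (use c in auto)
    finally show ?thesis .
  qed
  have r0: "S' r = \<zero> \<longleftrightarrow> S r = \<zero>"
    using p1 Sc[of r] Sr by (auto simp: l_minus)
  have "(\<forall>i<d. S' i = \<zero>) \<longleftrightarrow> (\<forall>i<d. S i = \<zero>)"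
  proof (cases "S r = \<zero>")
    case True
    then have "S' i = S i" if "i < d" for i
      using Si[OF that] r0 Sc[of i] by (cases "i = r") auto
    then show ?thesis by auto
  next
    case False
    then show ?thesis using r r0 by auto
  qed
  then show ?thesis unfolding null_vector_def S_def S'_def by simp
qed

lemma null_vector_reaches:
  assumes "reaches d N A b A' b'" "stably_proportional d N A b" "signs_on {..<N} d A"
    and c: "c \<in> {..<N} \<rightarrow> carrier R"
  shows "null_vector R d N (\<lambda>i j. sign_in R (A' i j)) c \<longleftrightarrow>
    null_vector R d N (\<lambda>i j. sign_in R (A i j)) c"
  using assms(1,2,3)
proof (induction rule: reaches.induct)
  case (step A' b' r f)
  have "signs_on {..<N} d A'" "signs_on {..<N} d (pivot r f A')"
    by (rule signs_on_reaches; use step reaches.step[OF step(1-4)] in blast)+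
  with null_vector_pivot[where c = c, OF c, of r d f A'] step show ?case by auto
qed auto

lemma finsum_eq_single_term:
  assumes "finite I" "k \<in> I" "g \<in> I \<rightarrow> carrier R" "\<And>j. j \<in> I \<Longrightarrow> j \<noteq> k \<Longrightarrow> g j = \<zero>"
  shows "(\<Oplus>j\<in>I. g j) = g k"
proof -
  have "(\<Oplus>j\<in>I. g j) = (\<Oplus>j\<in>I. if k = j then g j else \<zero>)"
    by (rule finsum_cong') (use assms in auto)
  also have "\<dots> = g k" by (rule finsum_singleton) (use assms in auto)
  finally show ?thesis .
qed

end

text \<open>
  Subsets of a basis that is reached are independent because their columns are distinct unit
  vectors there. For the other direction take a tableau whose basis contains as much of an
  independent set \<open>J\<close> as possible. If some \<open>j\<close> in \<open>J\<close> is left out, then column \<open>j\<close> can only be non-zero in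
  rows whose basis column lies in \<open>J\<close>, as otherwise a pivot would be an improvement; but then
  column \<open>j\<close> is a combination of other columns of \<open>J\<close>.
\<close>

lemma (in Ring.field) column_matroid_sign_tableau:
  fixes A :: "nat \<Rightarrow> nat \<Rightarrow> 'c::field_char_0"
  assumes tab: "is_tableau d N A b" and sp: "stably_proportional d N A b"
    and sg: "signs_on {..<N} d A"
  shows "column_matroid R (mat d N (\<lambda>(i, j). sign_in R (A i j))) =
    {J. J \<subseteq> {..<N} \<and> (\<exists>A' b'. reaches d N A b A' b' \<and> J \<subseteq> b' ` {..<d})}"
proof -
  let ?M = "mat d N (\<lambda>(i, j). sign_in R (A i j))"
  have M: "?M \<in> carrier_mat d N" by simp
  have nv_M: "null_vector R d N (\<lambda>i j. ?M $$ (i, j)) c = null_vector R d N (\<lambda>i j. sign_in R (A i j)) c"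
    if "c \<in> {..<N} \<rightarrow> carrier R" for c
  proof -
    have "(\<Oplus>j\<in>{..<N}. ?M $$ (i, j) \<otimes> c j) = (\<Oplus>j\<in>{..<N}. sign_in R (A i j) \<otimes> c j)" if "i < d" for i
      by (rule finsum_cong') (use that \<open>c \<in> _\<close> in auto)
    then show ?thesis unfolding null_vector_def by simp
  qed
  have indep: "J \<in> column_matroid R ?M \<longleftrightarrow> J \<subseteq> {..<N} \<and>
    (\<forall>c \<in> {..<N} \<rightarrow> carrier R. (\<forall>j\<in>{..<N} - J. c j = \<zero>) \<longrightarrow>
      null_vector R d N (\<lambda>i j. sign_in R (A i j)) c \<longrightarrow> (\<forall>j<N. c j = \<zero>))" for J
    by (subst column_matroid_iff_null_vectors[OF M]) (use nv_M in \<open>auto simp: elements_mat_def\<close>)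
  show ?thesis
  proof (rule Set.set_eqI, rule iffI)
    fix J assume "J \<in> {J. J \<subseteq> {..<N} \<and> (\<exists>A' b'. reaches d N A b A' b' \<and> J \<subseteq> b' ` {..<d})}"
    then obtain A' b' where J: "J \<subseteq> {..<N}" "J \<subseteq> b' ` {..<d}" and R: "reaches d N A b A' b'" by blast
    have tab': "is_tableau d N A' b'" by (rule is_tableau_reaches[OF R tab])
    have "\<forall>j<N. c j = \<zero>" if c: "c \<in> {..<N} \<rightarrow> carrier R" "\<forall>j\<in>{..<N} - J. c j = \<zero>"
      "null_vector R d N (\<lambda>i j. sign_in R (A i j)) c" for c
    proof -
      have nv: "null_vector R d N (\<lambda>i j. sign_in R (A' i j)) c"
        using null_vector_reaches[OF R sp sg c(1)] c(3) by simp
      have "c (b' i) = \<zero>" if i: "i < d" for i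
      proof -
        have bi: "b' i < N" by (rule is_tableau_basis_less[OF tab' i])
        have "(\<Oplus>j\<in>{..<N}. sign_in R (A' i j) \<otimes> c j) = sign_in R (A' i (b' i)) \<otimes> c (b' i)"
        proof (rule finsum_eq_single_term)
          fix j assume j: "j \<in> {..<N}" "j \<noteq> b' i"
          show "sign_in R (A' i j) \<otimes> c j = \<zero>"
          proof (cases "j \<in> J")
            case True
            then obtain k where "j = b' k" "k < d" using J by auto
            then have "A' i j = 0" using is_tableau_unit[OF tab' _ i, of k] j by auto
            then show ?thesis using c(1) j by (auto simp: Pi_iff)
          qed (use c(2) j in auto)
        qed (use c bi in auto)
        then show ?thesis
          using nv i is_tableau_unit[OF tab' i i] c(1) bi by (auto simp: null_vector_def Pi_iff)
      qed
      then show ?thesis using J c by blast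
    qed
    then show "J \<in> column_matroid R ?M" unfolding indep using J by blast
  next
    fix J assume L: "J \<in> column_matroid R ?M"
    then have JN: "J \<subseteq> {..<N}" unfolding indep by blast
    then have Jfin: "finite J" by (rule finite_subset) simp
    let ?P = "\<lambda>m. \<exists>A' b'. reaches d N A b A' b' \<and> card (J \<inter> b' ` {..<d}) = m"
    have "?P (card (J \<inter> b ` {..<d}))" using reaches.initial by blast
    moreover have "\<forall>m. ?P m \<longrightarrow> m \<le> card J" using Jfin by (auto intro: card_mono)
    ultimately obtain m where "?P m" and max: "\<And>m'. ?P m' \<Longrightarrow> m' \<le> m"
      using Nat.ex_has_greatest_nat[of ?P] by metis
    then obtain A' b' where R: "reaches d N A b A' b'" and m: "card (J \<inter> b' ` {..<d}) = m" by blast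
    have tab': "is_tableau d N A' b'" by (rule is_tableau_reaches[OF R tab])
    have "J \<subseteq> b' ` {..<d}"
    proof (rule ccontr)
      assume "\<not> J \<subseteq> b' ` {..<d}"
      then obtain j where j: "j \<in> J" "j \<notin> b' ` {..<d}" by blast
      have jN: "j < N" using j JN by auto
      have supp: "b' i \<in> J" if i: "i < d" "A' i j \<noteq> 0" for i
      proof (rule ccontr)
        assume bi: "b' i \<notin> J"
        have "reaches d N A b (pivot i j A') (b'(i := j))"
          by (rule reaches.step[OF R]) (use i jN in auto)
        then have "card (J \<inter> (b'(i := j)) ` {..<d}) \<le> m" using max by blast
        moreover have "J \<inter> (b'(i := j)) ` {..<d} \<supseteq> insert j (J \<inter> b' ` {..<d})"
          using j i bi by (auto simp: image_iff split: if_splits)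
        then have "card (insert j (J \<inter> b' ` {..<d})) \<le> card (J \<inter> (b'(i := j)) ` {..<d})"
          using Jfin by (intro card_mono) auto
        ultimately show False using m j Jfin by simp
      qed
      \<comment> \<open>The relation that expresses column \<open>j\<close> through the unit vectors.\<close>
      define c where "c = (\<lambda>l. if l = j then \<one> else if l \<in> b' ` {..<d}
        then \<ominus> sign_in R (A' (the_inv_into {..<d} b' l) j) else \<zero>)"
      have c: "c \<in> {..<N} \<rightarrow> carrier R" by (auto simp: c_def)
      have cj: "c j = \<one>" by (simp add: c_def)
      have cb: "c (b' i) = \<ominus> sign_in R (A' i j)" if "i < d" for i
        using that j the_inv_into_f_f[OF is_tableau_inj[OF tab'], of i] by (auto simp: c_def)
      have c0: "c l = \<zero>" if "l \<noteq> j" "l \<notin> b' ` {..<d}" for l using that by (auto simp: c_def)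
      have "\<forall>l\<in>{..<N} - J. c l = \<zero>"
      proof
        fix l assume l: "l \<in> {..<N} - J"
        show "c l = \<zero>"
        proof (cases "l \<in> b' ` {..<d}")
          case True
          then obtain i where i: "l = b' i" "i < d" by auto
          then have "A' i j = 0" using supp l by auto
          then show ?thesis using cb i by simp
        qed (use c0[of l] l j in auto)
      qed
      moreover have "null_vector R d N (\<lambda>i j. sign_in R (A' i j)) c"
        unfolding null_vector_def
      proof (intro allI impI)
        fix i assume i: "i < d"
        let ?g = "\<lambda>l. sign_in R (A' i l) \<otimes> c l"
        have g: "?g \<in> {..<N} \<rightarrow> carrier R" using c by auto
        have bi: "b' i \<in> {..<N} - {j}" using is_tableau_basis_less[OF tab' i] j i by auto
        have "(\<Oplus>l\<in>{..<N}. ?g l) = (\<Oplus>l\<in>insert j ({..<N} - {j}). ?g l)"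
          using jN by (simp add: insert_absorb)
        also have "\<dots> = ?g j \<oplus> (\<Oplus>l\<in>{..<N} - {j}. ?g l)"
          by (rule finsum_insert) (use g jN in auto)
        also have "(\<Oplus>l\<in>{..<N} - {j}. ?g l) = ?g (b' i)"
        proof (rule finsum_eq_single_term)
          fix l assume l: "l \<in> {..<N} - {j}" "l \<noteq> b' i"
          show "?g l = \<zero>"
          proof (cases "l \<in> b' ` {..<d}")
            case True
            then obtain k where "l = b' k" "k < d" by auto
            then have "A' i l = 0" using is_tableau_unit[OF tab' _ i, of k] l by auto
            then show ?thesis using c l by (auto simp: Pi_iff)
          qed (use c0 l in auto)
        qed (use g bi in auto)
        also have "?g j \<oplus> ?g (b' i) = \<zero>"
          using is_tableau_unit[OF tab' i i] cb[OF i] cj by (simp add: r_neg)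
        finally show "(\<Oplus>l\<in>{..<N}. ?g l) = \<zero>" .
      qed
      then have "null_vector R d N (\<lambda>i j. sign_in R (A i j)) c"
        using null_vector_reaches[OF R sp sg c] by simp
      ultimately have "c j = \<zero>" using L c jN unfolding indep by blast
      with cj show False by simp
    qed
    with R JN show "J \<in> {J. J \<subseteq> {..<N} \<and> (\<exists>A' b'. reaches d N A b A' b' \<and> J \<subseteq> b' ` {..<d})}" by blast
  qed
qed

lemma regular_matroid_sign_tableau:
  fixes A :: "nat \<Rightarrow> nat \<Rightarrow> 'a::field_char_0"
  assumes "is_tableau d N A b" "stably_proportional d N A b" "signs_on {..<N} d A"
  shows "regular_matroid TYPE('u) N {J. J \<subseteq> {..<N} \<and> (\<exists>A' b'. reaches d N A b A' b' \<and> J \<subseteq> b' ` {..<d})}"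
  unfolding regular_matroid_def representable_over_def
proof (intro allI impI)
  fix F :: "'u ring" assume "Ring.field F"
  then interpret Ring.field F .
  let ?M = "mat d N (\<lambda>(i, j). sign_in F (A i j))"
  have "elements_mat ?M \<subseteq> carrier F" by (auto simp: elements_mat_def)
  then show "\<exists>r. \<exists>M\<in>carrier_mat r N. elements_mat M \<subseteq> carrier F \<and> column_matroid F M =
      {J. J \<subseteq> {..<N} \<and> (\<exists>A' b'. reaches d N A b A' b' \<and> J \<subseteq> b' ` {..<d})}"
    using column_matroid_sign_tableau[OF assms] by (intro exI[of _ d] bexI[of _ ?M]) auto
qed

section \<open>Four-point lines over the field with two elements\<close>

text \<open>
  A relation among the columns of \<open>J\<close> must involve each \<open>j\<close> whose removal makes \<open>J\<close> independent, and
  over two elements the coefficient can then only be 1.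
\<close>

lemma (in Ring.field) two_element_circuit_relation:
  assumes two: "carrier R = {\<zero>, \<one>}"
    and A: "A \<in> carrier_mat r N" and AF: "elements_mat A \<subseteq> carrier R"
    and J: "J \<subseteq> {..<N}" "J \<notin> column_matroid R A"
  obtains c where "c \<in> {..<N} \<rightarrow> carrier R" "\<And>j. j \<in> {..<N} - J \<Longrightarrow> c j = \<zero>"
    "null_vector R r N (\<lambda>i j. A $$ (i, j)) c"
    "\<And>j. j \<in> J \<Longrightarrow> J - {j} \<in> column_matroid R A \<Longrightarrow> c j = \<one>"
proof -
  note iff = column_matroid_iff_null_vectors[OF A AF]
  have "\<not> (\<forall>c \<in> {..<N} \<rightarrow> carrier R. (\<forall>j\<in>{..<N} - J. c j = \<zero>) \<longrightarrow>
      null_vector R r N (\<lambda>i j. A $$ (i, j)) c \<longrightarrow> (\<forall>j<N. c j = \<zero>))"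
    using J iff[of J] by (simp only: simp_thms)
  then obtain c where c: "c \<in> {..<N} \<rightarrow> carrier R" "\<forall>j\<in>{..<N} - J. c j = \<zero>"
    "null_vector R r N (\<lambda>i j. A $$ (i, j)) c" "\<not> (\<forall>j<N. c j = \<zero>)"
    by (simp only: Set.ball_simps bex_simps not_imp) (elim bexE conjE, rule that)
  have "c j = \<one>" if j: "j \<in> J" "J - {j} \<in> column_matroid R A" for j
  proof (rule ccontr)
    assume "c j \<noteq> \<one>"
    moreover have "c j \<in> carrier R" using c(1) j J by auto
    ultimately have "c j = \<zero>" using two by auto
    then have "\<forall>l\<in>{..<N} - (J - {j}). c l = \<zero>" using c(2) by auto
    moreover have "\<forall>c \<in> {..<N} \<rightarrow> carrier R. (\<forall>l\<in>{..<N} - (J - {j}). c l = \<zero>) \<longrightarrow>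
      null_vector R r N (\<lambda>i j. A $$ (i, j)) c \<longrightarrow> (\<forall>l<N. c l = \<zero>)"
      using j(2) unfolding iff by blast
    ultimately have "\<forall>l<N. c l = \<zero>" using c(1,3) by metis
    with c(4) show False ..
  qed
  with c that show ?thesis by blast
qed

text \<open>
  Add the relation on \<open>B\<close> with \<open>v\<close>, \<open>w\<close>, \<open>x\<close> to the one on \<open>B\<close> with \<open>v\<close>, \<open>w\<close>, \<open>y\<close>: the coefficients
  1 at \<open>v\<close> and \<open>w\<close> cancel while the one at \<open>x\<close> remains, contradicting the independence of \<open>B\<close> with \<open>x\<close>, \<open>y\<close>.
\<close>

lemma (in Ring.field) two_element_no_four_point_line:
  assumes two: "carrier R = {\<zero>, \<one>}"
    and A: "A \<in> carrier_mat r N" and AF: "elements_mat A \<subseteq> carrier R"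
    and dist: "distinct [v, w, x, y]" and vwxy: "{v, w, x, y} \<subseteq> {..<N} - B"
    and pairs: "B \<union> {v, w} \<in> column_matroid R A" "B \<union> {v, x} \<in> column_matroid R A"
      "B \<union> {v, y} \<in> column_matroid R A" "B \<union> {w, x} \<in> column_matroid R A"
      "B \<union> {w, y} \<in> column_matroid R A" "B \<union> {x, y} \<in> column_matroid R A"
    and triples: "B \<union> {v, w, x} \<notin> column_matroid R A" "B \<union> {v, w, y} \<notin> column_matroid R A"
  shows False
proof -
  have AF': "A $$ (i, j) \<in> carrier R" if "i < r" "j < N" for i j
    using elements_matI[OF A that refl] AF by blast
  note iff = column_matroid_iff_null_vectors[OF A AF]
  have B: "B \<subseteq> {..<N}" using pairs(1) unfolding iff by blast
  have minus: "B \<union> {v, w, x} - {v} = B \<union> {w, x}" "B \<union> {v, w, x} - {w} = B \<union> {v, x}"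
    "B \<union> {v, w, x} - {x} = B \<union> {v, w}" "B \<union> {v, w, y} - {v} = B \<union> {w, y}"
    "B \<union> {v, w, y} - {w} = B \<union> {v, y}" "B \<union> {v, w, y} - {y} = B \<union> {v, w}"
    using dist vwxy by auto
  obtain c where c: "c \<in> {..<N} \<rightarrow> carrier R" "\<And>j. j \<in> {..<N} - (B \<union> {v, w, x}) \<Longrightarrow> c j = \<zero>"
    "null_vector R r N (\<lambda>i j. A $$ (i, j)) c"
    "\<And>j. j \<in> B \<union> {v, w, x} \<Longrightarrow> B \<union> {v, w, x} - {j} \<in> column_matroid R A \<Longrightarrow> c j = \<one>"
    using two_element_circuit_relation[OF two A AF _ triples(1)] B vwxy by auto
  obtain e where e: "e \<in> {..<N} \<rightarrow> carrier R" "\<And>j. j \<in> {..<N} - (B \<union> {v, w, y}) \<Longrightarrow> e j = \<zero>"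
    "null_vector R r N (\<lambda>i j. A $$ (i, j)) e"
    "\<And>j. j \<in> B \<union> {v, w, y} \<Longrightarrow> B \<union> {v, w, y} - {j} \<in> column_matroid R A \<Longrightarrow> e j = \<one>"
    using two_element_circuit_relation[OF two A AF _ triples(2)] B vwxy by auto
  have c1: "c v = \<one>" "c w = \<one>" "c x = \<one>"
    using c(4)[of v] c(4)[of w] c(4)[of x] pairs unfolding minus by auto
  have e1: "e v = \<one>" "e w = \<one>"
    using e(4)[of v] e(4)[of w] pairs unfolding minus by auto
  have ex: "e x = \<zero>" using e(2)[of x] dist vwxy by auto
  have "\<one> \<oplus> \<one> \<in> {\<zero>, \<one>}" unfolding two[symmetric] by simp
  then have 2: "\<one> \<oplus> \<one> = \<zero>" by auto
  define s where "s = (\<lambda>j. c j \<oplus> e j)"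
  have s: "s \<in> {..<N} \<rightarrow> carrier R" using c(1) e(1) by (auto simp: s_def)
  have "s j = \<zero>" if j: "j \<in> {..<N} - (B \<union> {x, y})" for j
  proof (cases "j = v \<or> j = w")
    case True
    then show ?thesis using c1 e1 2 by (auto simp: s_def)
  next
    case False
    then have "c j = \<zero>" "e j = \<zero>" using c(2)[of j] e(2)[of j] j by auto
    then show ?thesis by (simp add: s_def)
  qed
  moreover have "null_vector R r N (\<lambda>i j. A $$ (i, j)) s"
    unfolding null_vector_def
  proof (intro allI impI)
    fix i assume i: "i < r"
    have "(\<Oplus>j\<in>{..<N}. A $$ (i, j) \<otimes> s j) = (\<Oplus>j\<in>{..<N}. A $$ (i, j) \<otimes> c j \<oplus> A $$ (i, j) \<otimes> e j)"
      by (rule finsum_cong') (use AF' i c(1) e(1) in \<open>auto simp: s_def r_distr Pi_iff\<close>)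
    also have "\<dots> = (\<Oplus>j\<in>{..<N}. A $$ (i, j) \<otimes> c j) \<oplus> (\<Oplus>j\<in>{..<N}. A $$ (i, j) \<otimes> e j)"
      by (rule finsum_addf) (use AF' i c(1) e(1) in \<open>auto simp: Pi_iff\<close>)
    also have "\<dots> = \<zero>" using c(3) e(3) i by (simp add: null_vector_def)
    finally show "(\<Oplus>j\<in>{..<N}. A $$ (i, j) \<otimes> s j) = \<zero>" .
  qed
  ultimately have "\<forall>j<N. s j = \<zero>" using pairs(6) s unfolding iff by blast
  then have "s x = \<zero>" using vwxy by auto
  then show False using c1 ex by (simp add: s_def)
qed

text \<open>
  Any two elements of the universe \<open>'u\<close> serve as 0 and 1.
\<close>

lemma ex_two_element_field:
  assumes "infinite (UNIV :: 'u set)"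
  obtains F :: "'u ring" where "Ring.field F" "carrier F = {\<zero>\<^bsub>F\<^esub>, \<one>\<^bsub>F\<^esub>}"
proof -
  obtain z :: 'u where True by blast
  obtain u :: 'u where zu: "u \<noteq> z" using assms ex_new_if_finite[of "{z}"] by auto
  define F :: "'u ring" where "F = \<lparr>carrier = {z, u}, mult = (\<lambda>x y. if x = u \<and> y = u then u else z),
    one = u, zero = z, add = (\<lambda>x y. if x = y then z else u)\<rparr>"
  have "Ring.cring F"
  proof (rule Ring.cringI)
    show "abelian_group F"
      by (rule abelian_groupI) (use zu in \<open>auto simp: F_def\<close>)
    show "Group.comm_monoid F"
      by (rule comm_monoidI) (use zu in \<open>auto simp: F_def\<close>)
  qed (use zu in \<open>auto simp: F_def\<close>)
  then have "Ring.field F"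
    by (rule Ring.cring.cring_fieldI2) (use zu in \<open>auto simp: F_def\<close>)
  then show ?thesis by (rule that) (simp add: F_def)
qed

lemma regular_matroid_no_four_point_line:
  assumes "infinite (UNIV :: 'u set)" "regular_matroid TYPE('u) N \<M>"
    and "distinct [v, w, x, y]" "{v, w, x, y} \<subseteq> {..<N} - B"
    and "B \<union> {v, w} \<in> \<M>" "B \<union> {v, x} \<in> \<M>" "B \<union> {v, y} \<in> \<M>"
      "B \<union> {w, x} \<in> \<M>" "B \<union> {w, y} \<in> \<M>" "B \<union> {x, y} \<in> \<M>"
    and "B \<union> {v, w, x} \<notin> \<M>" "B \<union> {v, w, y} \<notin> \<M>"
  shows False
proof -
  obtain F :: "'u ring" where F: "Ring.field F" and two: "carrier F = {\<zero>\<^bsub>F\<^esub>, \<one>\<^bsub>F\<^esub>}"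
    using ex_two_element_field[OF assms(1)] .
  obtain r A where A: "A \<in> carrier_mat r N" "elements_mat A \<subseteq> carrier F" "column_matroid F A = \<M>"
    using assms(2) F unfolding regular_matroid_def representable_over_def by blast
  show False
    by (rule field.two_element_no_four_point_line[OF F two A(1,2) assms(3,4)])
      (use assms A(3) in auto)
qed

section \<open>Alternating functions of index lists\<close>

text \<open>
  The exponent of the sign in \<open>bracket\<close>.
\<close>

definition inversions :: "nat list \<Rightarrow> nat" where
  "inversions B = card {(i, j). i < j \<and> j < length B \<and> B ! j < B ! i}"

lemma inversions_Nil [simp]: "inversions [] = 0"
  by (simp add: inversions_def)

lemma inversions_Cons [simp]: "inversions (x # B) = length (filter (\<lambda>y. y < x) B) + inversions B"
proof -
  let ?I = "{(i, j). i < j \<and> j < length B \<and> B ! j < B ! i}"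
  let ?H = "{j. j < length B \<and> B ! j < x}"
  have fin: "finite ?I" by (rule finite_subset[of _ "{..<length B} \<times> {..<length B}"]) auto
  have "{(i, j). i < j \<and> j < length (x # B) \<and> (x # B) ! j < (x # B) ! i} =
    (\<lambda>j. (0, Suc j)) ` ?H \<union> map_prod Suc Suc ` ?I"
    (is "?L = ?R")
  proof
    show "?L \<subseteq> ?R"
    proof
      fix q assume "q \<in> ?L"
      then obtain i j where "q = (i, j)" "i < j" "j < length (x # B)" "(x # B) ! j < (x # B) ! i" by blast
      then show "q \<in> ?R" by (cases i; cases j) (auto simp: image_iff)
    qed
  qed auto
  moreover have "card ((\<lambda>j. (0::nat, Suc j)) ` ?H \<union> map_prod Suc Suc ` ?I) =
    card ((\<lambda>j. (0::nat, Suc j)) ` ?H) + card (map_prod Suc Suc ` ?I)"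
    using fin by (intro card_Un_disjoint) auto
  moreover have "card ((\<lambda>j. (0::nat, Suc j)) ` ?H) = card ?H"
    by (rule card_image) (auto simp: inj_on_def)
  moreover have "card (map_prod Suc Suc ` ?I) = card ?I"
    by (rule card_image) (auto simp: inj_on_def)
  ultimately show ?thesis by (simp add: inversions_def length_filter_conv_card)
qed

lemma inversions_swap: "x < y \<Longrightarrow> inversions (us @ y # x # vs) = Suc (inversions (us @ x # y # vs))"
  by (induction us) auto

lemma inversions_sorted: "sorted B \<Longrightarrow> inversions B = 0"
  by (induction B) (auto simp: filter_empty_conv not_less)

definition alternating :: "nat \<Rightarrow> (nat list \<Rightarrow> 'a::comm_ring_1) \<Rightarrow> bool" where
  "alternating d f \<longleftrightarrow>
    (\<forall>us x y vs. length (us @ x # y # vs) = d \<longrightarrow> f (us @ y # x # vs) = - f (us @ x # y # vs))"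

lemma alternating_swap:
  assumes "alternating d f" "length us + length vs + 2 = d"
  shows "f (us @ y # x # vs) = - f (us @ x # y # vs)"
proof -
  have "length (us @ x # y # vs) = d" using assms(2) by simp
  with assms(1) show ?thesis unfolding alternating_def by blast
qed

text \<open>
  Bubble sort: an adjacent descent exists as long as the list is not sorted, and exchanging it
  lowers the number of inversions by exactly one.
\<close>

lemma alternating_sort:
  assumes alt: "alternating d f" and "length B = d" "distinct B"
  shows "f B = (- 1) ^ inversions B * f (sorted_list_of_set (set B))"
  using assms(2,3)
proof (induction "inversions B" arbitrary: B)
  case (0 B)
  have "sorted B"
  proof (rule ccontr)
    assume "\<not> sorted B"
    then obtain i where i: "Suc i < length B" "B ! Suc i < B ! i"
      unfolding sorted_iff_nth_Suc by (auto simp: not_le)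
    then have "B = take i B @ B ! i # B ! Suc i # drop (Suc (Suc i)) B"
      by (metis Cons_nth_drop_Suc Suc_lessD append_take_drop_id)
    with inversions_swap[OF i(2)] 0(1) show False by (metis nat.distinct(1))
  qed
  with 0 show ?case by (simp add: sorted_list_of_set.idem_if_sorted_distinct)
next
  case (Suc n B)
  have "\<not> sorted B" using inversions_sorted Suc(2) by auto
  then obtain i where i: "Suc i < length B" "B ! Suc i < B ! i"
    unfolding sorted_iff_nth_Suc by (auto simp: not_le)
  define us vs where "us = take i B" and "vs = drop (Suc (Suc i)) B"
  define C where "C = us @ B ! Suc i # B ! i # vs"
  have B: "B = us @ B ! i # B ! Suc i # vs"
    unfolding us_def vs_def using i by (metis Cons_nth_drop_Suc Suc_lessD append_take_drop_id)
  have inv: "inversions B = Suc (inversions C)"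
    unfolding C_def by (subst B) (rule inversions_swap[OF i(2)])
  have "length C = length B" "distinct C \<longleftrightarrow> distinct B" "set C = set B"
    unfolding C_def by (subst (2) B; auto)+
  moreover have "f B = - f C"
    unfolding C_def by (subst B, rule alternating_swap[OF alt])
      (use Suc.prems B in \<open>metis add_Suc_right length_Cons length_append add_2_eq_Suc' \<close>)
  ultimately show ?case using Suc inv by simp
qed

lemma alternating_move_to_front:
  assumes alt: "alternating d f"
  shows "length us + length vs + 1 = d \<Longrightarrow> f (us @ x # vs) = (- 1) ^ length us * f (x # us @ vs)"
proof (induction us arbitrary: vs rule: rev_induct)
  case (snoc u us)
  have "f ((us @ [u]) @ x # vs) = - f (us @ x # u # vs)"
    using alternating_swap[OF alt, of us vs u x] snoc(2) by simp
  with snoc show ?case by simp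
qed simp

lemma alternating_not_distinct:
  fixes f :: "nat list \<Rightarrow> 'a::field_char_0"
  assumes alt: "alternating d f" and "length B = d" "\<not> distinct B"
  shows "f B = 0"
proof -
  obtain us vs ws y where B: "B = us @ [y] @ vs @ [y] @ ws"
    using not_distinct_decomp[OF assms(3)] by blast
  have "f B = (-1) ^ length us * f ((y # us @ vs) @ y # ws)"
    using alternating_move_to_front[OF alt, of us "vs @ y # ws" y] assms(2) B by simp
  also have "f ((y # us @ vs) @ y # ws) = (-1) ^ length (y # us @ vs) * f (y # y # us @ vs @ ws)"
    using alternating_move_to_front[OF alt, of "y # us @ vs" ws y] assms(2) B by simp
  also have "f (y # y # us @ vs @ ws) = 0"
    using alternating_swap[OF alt, of "[]" "us @ vs @ ws" y y] assms(2) B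
    by (simp add: equal_neg_zero)
  finally show ?thesis by simp
qed

text \<open>
  The value of the polynomial \<open>bracket B\<close> at the point \<open>x\<close>, see \<open>eval_poly_bracket\<close>.
\<close>

definition bracket_value :: "(nat set \<Rightarrow> 'a::comm_ring_1) \<Rightarrow> nat list \<Rightarrow> 'a" where
  "bracket_value x B = (if distinct B then (- 1) ^ inversions B * x (set B) else 0)"

lemma alternating_bracket_value: "alternating d (bracket_value x)"
  unfolding alternating_def
proof (intro allI impI)
  fix us vs :: "nat list" and a b :: nat
  let ?u = "us @ a # b # vs" and ?w = "us @ b # a # vs"
  have same: "set ?w = set ?u" "distinct ?w = distinct ?u" by auto
  show "bracket_value x ?w = - bracket_value x ?u"
  proof (cases "distinct ?u")
    case True
    then have "a < b \<or> b < a" by auto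
    then have "inversions ?w = Suc (inversions ?u) \<or> inversions ?u = Suc (inversions ?w)"
      using inversions_swap by blast
    then have "(- 1 :: 'a) ^ inversions ?w = - ((- 1) ^ inversions ?u)"
      by (metis minus_minus mult_minus1 power_Suc)
    then show ?thesis using True unfolding bracket_value_def same by simp
  next
    case False
    moreover have "\<not> distinct ?w" using False same by blast
    ultimately show ?thesis by (simp only: bracket_value_def if_False minus_zero)
  qed
qed

lemma bracket_value_sorted_list:
  "finite S \<Longrightarrow> bracket_value x (sorted_list_of_set S) = x S"
  by (simp add: bracket_value_def inversions_sorted)

section \<open>Maximal minors and the Grassmann-Pluecker relations\<close>

definition columns_det :: "nat \<Rightarrow> 'a::comm_ring_1 mat \<Rightarrow> nat list \<Rightarrow> 'a" where
  "columns_det d X B = det (mat d d (\<lambda>(i, j). X $$ (i, B ! j)))"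

lemma alternating_columns_det: "alternating d (columns_det d X)"
  unfolding alternating_def
proof (intro allI impI)
  fix us vs :: "nat list" and a b assume len: "length (us @ a # b # vs) = d"
  let ?M = "\<lambda>B. mat d d (\<lambda>(i, j). X $$ (i, B ! j))"
  let ?k = "length us"
  have "?M (us @ b # a # vs) = swapcols ?k (Suc ?k) (?M (us @ a # b # vs))"
    by (rule eq_matI) (use len in \<open>auto simp: nth_append nth_Cons split: nat.splits\<close>)
  moreover have "det (swapcols ?k (Suc ?k) (?M (us @ a # b # vs))) = - det (?M (us @ a # b # vs))"
    by (rule det_swapcols[of _ d]) (use len in auto)
  ultimately show "columns_det d X (us @ b # a # vs) = - columns_det d X (us @ a # b # vs)"
    by (simp add: columns_det_def)
qed

lemma pick_eq_sorted_list_of_set: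
  assumes "finite S" "j < card S"
  shows "pick S j = sorted_list_of_set S ! j"
proof -
  let ?l = "map (pick S) [0..<card S]"
  have sw: "sorted_wrt (<) ?l"
    by (auto simp: sorted_wrt_iff_nth_less intro: pick_mono_le)
  moreover have "set ?l = S"
  proof (rule card_subset_eq[OF assms(1)])
    show "set ?l \<subseteq> S" using pick_in_set_le by auto
    have "distinct ?l" using sw strict_sorted_iff by blast
    then show "card (set ?l) = card S" by (metis distinct_card length_map length_upt minus_nat.diff_0)
  qed
  ultimately have "sorted_list_of_set S = ?l"
    using sorted_list_of_set_unique[OF assms(1), of ?l] by simp
  then show ?thesis using assms by simp
qed

lemma wedge_rows_eq_columns_det:
  assumes X: "X \<in> carrier_mat d N" and S: "S \<in> basis_indices d N"
  shows "wedge_rows d N X S = columns_det d X (sorted_list_of_set S)"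
proof -
  have SN: "S \<subseteq> {..<N}" "card S = d" "finite S" using S finite_subset[of S "{..<N}"] by (auto simp: basis_indices_def)
  have "{j. j < N \<and> j \<in> S} = S" using SN by auto
  then have "submatrix X UNIV S = mat d d (\<lambda>(i, j). X $$ (i, sorted_list_of_set S ! j))"
    using X SN pick_eq_sorted_list_of_set[OF SN(3)]
    unfolding submatrix_def by (intro eq_matI) (auto simp: pick_UNIV)
  with S show ?thesis by (simp add: wedge_rows_def columns_det_def)
qed

lemma columns_det_eq_bracket_value:
  fixes X :: "'a::field_char_0 mat"
  assumes X: "X \<in> carrier_mat d N" and B: "length B = d" "set B \<subseteq> {..<N}"
  shows "columns_det d X B = bracket_value (wedge_rows d N X) B"
proof (cases "distinct B")
  case True
  then have "set B \<in> basis_indices d N" using B by (simp add: basis_indices_def distinct_card)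
  from wedge_rows_eq_columns_det[OF X this] show ?thesis
    using alternating_sort[OF alternating_columns_det B(1) True] True
    by (simp add: bracket_value_def)
qed (use alternating_not_distinct[OF alternating_columns_det B(1)] in \<open>auto simp: bracket_value_def\<close>)

text \<open>
  The minor of \<open>c # B\<close> is a linear form in column \<open>c\<close>, with coefficients \<open>C\<close> that only depend on
  \<open>B\<close>. Cramer's rule writes column \<open>b\<close>, multiplied by the minor of \<open>B'\<close>, as the combination of the columns
  \<open>B' ! i\<close> with coefficients the minors of \<open>B'[i := b]\<close>; in adjugate form it also holds when the
  minor of \<open>B'\<close> is zero. Apply the linear form to it.
\<close>

lemma columns_det_exchange:
  assumes "length (b # B) = d" "length B' = d"
  shows "columns_det d X (b # B) * columns_det d X B' =
    (\<Sum>i<d. columns_det d X (B' ! i # B) * columns_det d X (B'[i := b]))"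
proof -
  let ?M = "\<lambda>B. mat d d (\<lambda>(i, j). X $$ (i, B ! j))"
  define C where "C = (\<lambda>k. cofactor (?M (b # B)) k 0)"
  define D where "D = (\<lambda>k i. cofactor (?M B') k i)"
  have d: "0 < d" using assms by auto
  have first: "columns_det d X (c # B) = (\<Sum>k<d. X $$ (k, c) * C k)" for c
  proof -
    have "cofactor (?M (c # B)) k 0 = C k" for k
      unfolding C_def cofactor_def
      by (intro arg_cong2[where f = "(*)"] refl arg_cong[of _ _ det] eq_matI)
        (auto simp: mat_delete_def)
    then show ?thesis
      unfolding columns_det_def
      by (subst laplace_expansion_column[OF _ d]) (use d in auto)
  qed
  have upd: "columns_det d X (B'[i := b]) = (\<Sum>k<d. X $$ (k, b) * D k i)" if i: "i < d" for i
  proof -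
    have "cofactor (?M (B'[i := b])) k i = D k i" if "k < d" for k
      unfolding D_def cofactor_def
      by (intro arg_cong2[where f = "(*)"] refl arg_cong[of _ _ det] eq_matI)
        (use assms i that in \<open>auto simp: mat_delete_def nth_list_update\<close>)
    then show ?thesis
      unfolding columns_det_def
      by (subst laplace_expansion_column[OF _ i]) (use i assms in auto)
  qed
  have adj: "(\<Sum>i<d. X $$ (l, B' ! i) * D k i) = (if l = k then columns_det d X B' else 0)"
    if l: "l < d" and k: "k < d" for l k
  proof -
    have "(?M B' * adj_mat (?M B')) $$ (l, k) = (\<Sum>i<d. X $$ (l, B' ! i) * D k i)"
      using l k by (simp add: scalar_prod_def adj_mat_def D_def atLeast0LessThan)
    moreover have "(?M B' * adj_mat (?M B')) $$ (l, k) = det (?M B') * (if l = k then 1 else 0)"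
    proof -
      have "?M B' * adj_mat (?M B') = det (?M B') \<cdot>\<^sub>m 1\<^sub>m d" by (rule adj_mat(2)) simp
      then show ?thesis using l k by simp
    qed
    ultimately have "(\<Sum>i<d. X $$ (l, B' ! i) * D k i) = det (?M B') * (if l = k then 1 else 0)"
      by (simp only:)
    then show ?thesis by (auto simp: columns_det_def)
  qed
  have "(\<Sum>i<d. columns_det d X (B' ! i # B) * columns_det d X (B'[i := b])) =
    (\<Sum>i<d. \<Sum>l<d. \<Sum>k<d. (C l * X $$ (k, b)) * (X $$ (l, B' ! i) * D k i))"
    by (intro sum.cong HOL.refl) (simp add: first upd sum_product, simp add: ac_simps)
  also have "\<dots> = (\<Sum>l<d. \<Sum>k<d. \<Sum>i<d. (C l * X $$ (k, b)) * (X $$ (l, B' ! i) * D k i))"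
    by (subst sum.swap) (rule sum.cong[OF HOL.refl], rule sum.swap)
  also have "\<dots> = (\<Sum>l<d. \<Sum>k<d. (C l * X $$ (k, b)) * (if l = k then columns_det d X B' else 0))"
    by (intro sum.cong HOL.refl) (simp add: adj flip: sum_distrib_left)
  also have "\<dots> = (\<Sum>l<d. C l * X $$ (l, b) * columns_det d X B')"
    by (intro sum.cong HOL.refl) (simp add: if_distrib cong: if_cong)
  also have "\<dots> = columns_det d X (b # B) * columns_det d X B'"
    unfolding first sum_distrib_right by (intro sum.cong HOL.refl) (simp add: ac_simps)
  finally show ?thesis ..
qed

text \<open>
  An entry \<open>b\<close> of \<open>B\<close> outside \<open>T\<close> can be moved to the front and then be replaced, by the exchange relation
  with \<open>T\<close>, by entries of \<open>T\<close>. The number of entries outside \<open>T\<close> decreases until \<open>B\<close> is a permutation of \<open>T\<close>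
  or has repeated entries.
\<close>

lemma alternating_eqI_exchange:
  fixes f g :: "nat list \<Rightarrow> 'a::field_char_0"
  assumes alt: "alternating d f" "alternating d g"
    and T: "length T = d" "distinct T" "set T \<subseteq> {..<N}" "f T = 1" "g T = 1"
    and upd: "\<And>i b. i < d \<Longrightarrow> b < N \<Longrightarrow> f (T[i := b]) = g (T[i := b])"
    and exf: "\<And>b B. length (b # B) = d \<Longrightarrow> set (b # B) \<subseteq> {..<N} \<Longrightarrow>
      f (b # B) * f T = (\<Sum>i<d. f (T ! i # B) * f (T[i := b]))"
    and exg: "\<And>b B. length (b # B) = d \<Longrightarrow> set (b # B) \<subseteq> {..<N} \<Longrightarrow>
      g (b # B) * g T = (\<Sum>i<d. g (T ! i # B) * g (T[i := b]))"
    and "length B = d" "set B \<subseteq> {..<N}"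
  shows "f B = g B"
  using assms(11,12)
proof (induction "length (filter (\<lambda>b. b \<notin> set T) B)" arbitrary: B rule: less_induct)
  case less
  show ?case
  proof (cases "set B \<subseteq> set T")
    case True
    show ?thesis
    proof (cases "distinct B")
      case dist: True
      then have "set B = set T"
        using True T less by (metis card_subset_eq distinct_card finite_set)
      moreover have "f (sorted_list_of_set (set T)) = g (sorted_list_of_set (set T))"
        using alternating_sort[OF alt(1) T(1,2)] alternating_sort[OF alt(2) T(1,2)] T(4,5)
        by (metis mult_cancel_left power_eq_0_iff neg_equal_0_iff_equal one_neq_zero)
      ultimately show ?thesis
        using alternating_sort[OF alt(1) less(2) dist] alternating_sort[OF alt(2) less(2) dist] by simp
    next
      case False
      then show ?thesis using alternating_not_distinct[OF alt(1) less(2)] alternating_not_distinct[OF alt(2) less(2)] by simp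
    qed
  next
    case False
    then obtain b us vs where b: "b \<notin> set T" and B: "B = us @ b # vs"
      by (metis split_list subsetI)
    have len: "length (b # us @ vs) = d" using less B by simp
    have sub: "set (b # us @ vs) \<subseteq> {..<N}" using less B by auto
    have "f (T ! i # us @ vs) = g (T ! i # us @ vs)" if "i < d" for i
    proof -
      have Ti: "T ! i \<in> set T" using that T(1) by simp
      with T(3) have "T ! i < N" by auto
      with Ti show ?thesis using less(1)[of "T ! i # us @ vs"] b B len sub by auto
    qed
    then have "f (b # us @ vs) = g (b # us @ vs)"
      using exf[OF len sub] exg[OF len sub] T(4,5) upd[of _ b] sub by simp
    then show ?thesis
      using alternating_move_to_front[OF alt(1), of us vs b] alternating_move_to_front[OF alt(2), of us vs b] B len
      by simp
  qed
qed

text \<open>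
  The matrix is forced: if its columns at the sorted list \<open>T\<close> of \<open>S0\<close> are the unit vectors, then its
  entry at \<open>(i, e)\<close> must be the minor of \<open>T[i := e]\<close>. It is a tableau with basis \<open>T\<close>.
\<close>

lemma decomposable_if_exchange:
  fixes x :: "nat set \<Rightarrow> 'a::field_char_0"
  assumes rel: "\<And>b B B'. length (b # B) = d \<Longrightarrow> length B' = d \<Longrightarrow> set (b # B) \<subseteq> {..<N} \<Longrightarrow>
      set B' \<subseteq> {..<N} \<Longrightarrow> bracket_value x (b # B) * bracket_value x B' =
        (\<Sum>i<d. bracket_value x (B' ! i # B) * bracket_value x (B'[i := b]))"
    and S0: "S0 \<in> basis_indices d N" "x S0 \<noteq> 0"
  obtains X b where "X \<in> carrier_mat d N" "is_tableau d N (\<lambda>i j. X $$ (i, j)) b"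
    "\<And>S. S \<in> basis_indices d N \<Longrightarrow> wedge_rows d N X S = x S / x S0"
proof -
  define T where "T = sorted_list_of_set S0"
  have fin: "finite S0" using S0 finite_subset[of S0 "{..<N}"] by (auto simp: basis_indices_def)
  have T: "length T = d" "distinct T" "set T \<subseteq> {..<N}"
    using S0 fin by (auto simp: T_def basis_indices_def)
  define c where "c = x S0"
  have c: "c \<noteq> 0" "bracket_value x T = c" using S0 fin by (simp_all add: c_def T_def bracket_value_sorted_list)
  define X where "X = mat d N (\<lambda>(i, e). bracket_value x (T[i := e]) / c)"
  define h where "h = (\<lambda>B. bracket_value x B / c)"
  have X: "X \<in> carrier_mat d N" by (simp add: X_def)
  have Xh: "X $$ (i, e) = h (T[i := e])" if "i < d" "e < N" for i e
    using that by (simp add: X_def h_def)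
  have TN: "T ! k < N" if "k < d" for k using that T(1,3) nth_mem by blast
  have unit: "X $$ (i, T ! k) = (if i = k then 1 else 0)" if "i < d" "k < d" for i k
  proof (cases "i = k")
    case True
    then show ?thesis using Xh[OF that(1), of "T ! k"] TN[OF that(2)] that T c by (auto simp: h_def)
  next
    case False
    have "\<not> distinct (T[i := T ! k])"
    proof
      assume "distinct (T[i := T ! k])"
      then have "T[i := T ! k] ! i \<noteq> T[i := T ! k] ! k"
        using False that T(1) by (subst nth_eq_iff_index_eq) auto
      then show False using False that T(1) by simp
    qed
    then show ?thesis
      using Xh[OF that(1), of "T ! k"] TN[OF that(2)] that T False by (auto simp: h_def bracket_value_def)
  qed
  have tab: "is_tableau d N (\<lambda>i j. X $$ (i, j)) (\<lambda>k. T ! k)"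
    using unit TN by (auto simp: is_tableau_def)
  have detT: "columns_det d X T = 1"
  proof -
    have "mat d d (\<lambda>(i, j). X $$ (i, T ! j)) = 1\<^sub>m d" by (rule eq_matI) (auto simp: unit)
    then show ?thesis by (simp add: columns_det_def)
  qed
  \<comment> \<open>Cramer's rule for the unit matrix.\<close>
  have det_upd: "columns_det d X (T[i := e]) = h (T[i := e])" if i: "i < d" and e: "e < N" for i e
  proof -
    let ?v = "vec d (\<lambda>r. X $$ (r, e))"
    have "mat d d (\<lambda>(r, j). X $$ (r, T[i := e] ! j)) = replace_col (1\<^sub>m d) (1\<^sub>m d *\<^sub>v ?v) i"
      by (rule eq_matI) (use T i in \<open>auto simp: replace_col_def nth_list_update unit\<close>)
    then show ?thesis
      using cramer_lemma_mat[of "1\<^sub>m d" d ?v i] i Xh[OF i e] by (simp add: columns_det_def)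
  qed
  have alt_h: "alternating d h"
    unfolding alternating_def
  proof (intro allI impI)
    fix us vs :: "nat list" and a b assume "length (us @ a # b # vs) = d"
    then show "h (us @ b # a # vs) = - h (us @ a # b # vs)"
      using alternating_swap[OF alternating_bracket_value[of d x], of us vs b a] by (simp add: h_def)
  qed
  have det_h: "columns_det d X B = h B" if "length B = d" "set B \<subseteq> {..<N}" for B
  proof (rule alternating_eqI_exchange[OF alternating_columns_det alt_h T(1,2,3) detT _ det_upd _ _ that])
    show "h T = 1" using c by (simp add: h_def)
    fix b B assume B: "length (b # B) = d" "set (b # B) \<subseteq> {..<N}"
    show "columns_det d X (b # B) * columns_det d X T =
      (\<Sum>i<d. columns_det d X (T ! i # B) * columns_det d X (T[i := b]))"
      by (rule columns_det_exchange[OF B(1) T(1)])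
    show "h (b # B) * h T = (\<Sum>i<d. h (T ! i # B) * h (T[i := b]))"
      using rel[OF B(1) T(1) B(2) T(3)] by (simp add: h_def sum_divide_distrib[symmetric])
  qed
  show ?thesis
  proof (rule that[OF X tab])
    fix S assume S: "S \<in> basis_indices d N"
    then have "finite S" using finite_subset[of S "{..<N}"] by (auto simp: basis_indices_def)
    with S have "wedge_rows d N X S = h (sorted_list_of_set S)"
      unfolding wedge_rows_eq_columns_det[OF X S] by (intro det_h) (auto simp: basis_indices_def)
    then show "wedge_rows d N X S = x S / x S0"
      using \<open>finite S\<close> by (simp add: h_def c_def bracket_value_sorted_list)
  qed
qed

section \<open>Evaluation, degree and ideals in the bracket ring\<close>

definition monomial_value :: "(nat set \<Rightarrow> 'a::comm_ring_1) \<Rightarrow> (nat set \<Rightarrow>\<^sub>0 nat) \<Rightarrow> 'a" where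
  "monomial_value x m = (\<Prod>S \<in> Poly_Mapping.keys m. x S ^ Poly_Mapping.lookup m S)"

lemma monomial_value_superset:
  assumes "finite K" "Poly_Mapping.keys m \<subseteq> K"
  shows "monomial_value x m = (\<Prod>S\<in>K. x S ^ Poly_Mapping.lookup m S)"
  unfolding monomial_value_def
  by (rule prod.mono_neutral_left) (use assms in \<open>auto simp: in_keys_iff\<close>)

lemma monomial_value_add: "monomial_value x (m + n) = monomial_value x m * monomial_value x n"
proof -
  let ?K = "Poly_Mapping.keys m \<union> Poly_Mapping.keys n"
  have "monomial_value x (m + n) = (\<Prod>S\<in>?K. x S ^ Poly_Mapping.lookup (m + n) S)"
    by (rule monomial_value_superset) (use Poly_Mapping.keys_add[of m n] in auto)
  also have "\<dots> = (\<Prod>S\<in>?K. x S ^ Poly_Mapping.lookup m S) * (\<Prod>S\<in>?K. x S ^ Poly_Mapping.lookup n S)"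
    by (simp add: lookup_add power_add prod.distrib)
  also have "\<dots> = monomial_value x m * monomial_value x n"
    by (simp add: monomial_value_superset[of ?K])
  finally show ?thesis .
qed

lemma eval_poly_superset:
  assumes "finite K" "Poly_Mapping.keys p \<subseteq> K"
  shows "eval_poly x p = (\<Sum>m\<in>K. Poly_Mapping.lookup p m * monomial_value x m)"
  unfolding eval_poly_def monomial_value_def[symmetric]
  by (rule sum.mono_neutral_left) (use assms in \<open>auto simp: in_keys_iff\<close>)

lemma eval_poly_zero [simp]: "eval_poly x 0 = 0"
  by (simp add: eval_poly_def)

lemma eval_poly_single: "eval_poly x (Poly_Mapping.single m c) = c * monomial_value x m"
  by (subst eval_poly_superset[of "{m}"]) auto

lemma eval_poly_add: "eval_poly x (p + q) = eval_poly x p + eval_poly x q"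
proof -
  let ?K = "Poly_Mapping.keys p \<union> Poly_Mapping.keys q"
  have "eval_poly x (p + q) = (\<Sum>m\<in>?K. Poly_Mapping.lookup (p + q) m * monomial_value x m)"
    by (rule eval_poly_superset) (use Poly_Mapping.keys_add[of p q] in auto)
  also have "\<dots> = eval_poly x p + eval_poly x q"
    by (simp add: eval_poly_superset[of ?K] lookup_add distrib_right sum.distrib)
  finally show ?thesis .
qed

lemma eval_poly_diff: "eval_poly x (p - q) = eval_poly x p - eval_poly x q"
  using eval_poly_add[of x "p - q" q] by simp

lemma eval_poly_sum: "eval_poly x (sum f I) = (\<Sum>i\<in>I. eval_poly x (f i))"
  by (induction I rule: infinite_finite_induct) (auto simp: eval_poly_add)

lemma poly_mapping_eq_sum_single:
  "p = (\<Sum>m\<in>Poly_Mapping.keys p. Poly_Mapping.single m (Poly_Mapping.lookup p m))"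
proof (rule poly_mapping_eqI)
  fix k
  have "(\<Sum>m\<in>Poly_Mapping.keys p. Poly_Mapping.lookup (Poly_Mapping.single m (Poly_Mapping.lookup p m)) k) =
    (\<Sum>m\<in>Poly_Mapping.keys p. if m = k then Poly_Mapping.lookup p k else 0)"
    by (rule sum.cong) (auto simp: lookup_single)
  also have "\<dots> = Poly_Mapping.lookup p k" by (auto simp: in_keys_iff)
  finally show "Poly_Mapping.lookup p k = Poly_Mapping.lookup
      (\<Sum>m\<in>Poly_Mapping.keys p. Poly_Mapping.single m (Poly_Mapping.lookup p m)) k"
    by (simp add: lookup_sum)
qed

lemma eval_poly_mult: "eval_poly x (p * q) = eval_poly x p * eval_poly x q"
proof -
  let ?s = "\<lambda>p m. Poly_Mapping.single m (Poly_Mapping.lookup p m)"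
  have "p * q = (\<Sum>m\<in>Poly_Mapping.keys p. \<Sum>n\<in>Poly_Mapping.keys q. ?s p m * ?s q n)"
    by (subst poly_mapping_eq_sum_single[of p], subst poly_mapping_eq_sum_single[of q]) (rule sum_product)
  then have "eval_poly x (p * q) = (\<Sum>m\<in>Poly_Mapping.keys p. \<Sum>n\<in>Poly_Mapping.keys q.
      (Poly_Mapping.lookup p m * monomial_value x m) * (Poly_Mapping.lookup q n * monomial_value x n))"
    by (simp add: eval_poly_sum mult_single eval_poly_single monomial_value_add ac_simps)
  also have "\<dots> = eval_poly x p * eval_poly x q"
    by (simp add: eval_poly_def monomial_value_def sum_product)
  finally show ?thesis .
qed

lemma eval_poly_one [simp]: "eval_poly x 1 = 1"
  unfolding single_one[symmetric] eval_poly_single by (simp add: monomial_value_def)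

lemma eval_poly_prod: "eval_poly x (prod f I) = (\<Prod>i\<in>I. eval_poly x (f i))"
  by (induction I rule: infinite_finite_induct) (auto simp: eval_poly_mult)

lemma eval_poly_bracket: "eval_poly x (bracket B) = bracket_value x B"
  by (auto simp: bracket_def bracket_value_def eval_poly_single monomial_value_def inversions_def)

definition total_degree :: "(nat set \<Rightarrow>\<^sub>0 nat) \<Rightarrow> nat" where
  "total_degree m = (\<Sum>S \<in> Poly_Mapping.keys m. Poly_Mapping.lookup m S)"

lemma homogeneous_iff: "homogeneous k p \<longleftrightarrow> (\<forall>m \<in> Poly_Mapping.keys p. total_degree m = k)"
  by (simp add: homogeneous_def total_degree_def)

lemma total_degree_add: "total_degree (m + n) = total_degree m + total_degree n"
proof -
  let ?K = "Poly_Mapping.keys m \<union> Poly_Mapping.keys n"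
  have sup: "total_degree l = (\<Sum>S\<in>?K. Poly_Mapping.lookup l S)" if "Poly_Mapping.keys l \<subseteq> ?K" for l
    unfolding total_degree_def by (rule sum.mono_neutral_left) (use that in \<open>auto simp: in_keys_iff\<close>)
  have "Poly_Mapping.keys (m + n) \<subseteq> ?K" by (rule Poly_Mapping.keys_add)
  then show ?thesis by (simp add: sup lookup_add sum.distrib)
qed

lemma homogeneous_zero [simp]: "homogeneous k 0" by (simp add: homogeneous_def)

lemma homogeneous_mult: "homogeneous k p \<Longrightarrow> homogeneous l q \<Longrightarrow> homogeneous (k + l) (p * q)"
  using keys_mult[of p q] unfolding homogeneous_iff by (fastforce simp: total_degree_add)

lemma homogeneous_diff: "homogeneous k p \<Longrightarrow> homogeneous k q \<Longrightarrow> homogeneous k (p - q)"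
  using Poly_Mapping.keys_add[of p "- q"] unfolding homogeneous_iff
  by (metis UnE in_keys_iff lookup_minus diff_self diff_zero)

lemma homogeneous_sum: "(\<And>i. i \<in> I \<Longrightarrow> homogeneous k (f i)) \<Longrightarrow> homogeneous k (sum f I)"
proof (induction I rule: infinite_finite_induct)
  case (insert i I)
  then show ?case using Poly_Mapping.keys_add[of "f i" "sum f I"] unfolding homogeneous_iff by auto
qed auto

lemma homogeneous_one: "homogeneous 0 1"
  by (auto simp: homogeneous_def)

lemma homogeneous_prod:
  assumes "finite I" "\<And>i. i \<in> I \<Longrightarrow> homogeneous 1 (f i)"
  shows "homogeneous (card I) (prod f I)"
  using assms
proof (induction I rule: finite_induct)
  case (insert i I)
  then have "homogeneous (1 + card I) (f i * prod f I)" by (intro homogeneous_mult) auto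
  with insert show ?case by simp
qed (simp add: homogeneous_one)

lemma homogeneous_bracket: "homogeneous 1 (bracket B)"
  by (auto simp: bracket_def homogeneous_def split: if_splits)

lemma eval_poly_scale:
  assumes "homogeneous k p"
  shows "eval_poly (\<lambda>S. c * x S) p = c ^ k * eval_poly x p"
proof -
  have "monomial_value (\<lambda>S. c * x S) m = c ^ k * monomial_value x m" if "m \<in> Poly_Mapping.keys p" for m
    using assms that by (auto simp: homogeneous_def monomial_value_def power_mult_distrib prod.distrib simp flip: power_sum)
  then show ?thesis
    by (simp add: eval_poly_superset[of "Poly_Mapping.keys p"] sum_distrib_left ac_simps)
qed

lemma bracket_ring_zero [simp]: "0 \<in> bracket_ring d N" by (simp add: bracket_ring_def)

lemma bracket_ring_one [simp]: "1 \<in> bracket_ring d N" by (auto simp: bracket_ring_def)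

lemma bracket_ring_add: "p \<in> bracket_ring d N \<Longrightarrow> q \<in> bracket_ring d N \<Longrightarrow> p + q \<in> bracket_ring d N"
  using Poly_Mapping.keys_add[of p q] by (auto simp: bracket_ring_def)

lemma bracket_ring_mult:
  assumes "p \<in> bracket_ring d N" "q \<in> bracket_ring d N"
  shows "p * q \<in> bracket_ring d N"
  unfolding bracket_ring_def
proof (intro CollectI ballI)
  fix m assume "m \<in> Poly_Mapping.keys (p * q)"
  then obtain a b where "m = a + b" "a \<in> Poly_Mapping.keys p" "b \<in> Poly_Mapping.keys q"
    using keys_mult[of p q] by blast
  then show "Poly_Mapping.keys m \<subseteq> basis_indices d N"
    using assms Poly_Mapping.keys_add[of a b] unfolding bracket_ring_def by blast
qed

lemma bracket_ring_single: "Poly_Mapping.keys m \<subseteq> basis_indices d N \<Longrightarrow> Poly_Mapping.single m c \<in> bracket_ring d N"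
  by (simp add: bracket_ring_def)

lemma bracket_ring_uminus: "p \<in> bracket_ring d N \<Longrightarrow> - p \<in> bracket_ring d N"
  by (auto simp: bracket_ring_def in_keys_iff)

lemma bracket_ring_diff: "p \<in> bracket_ring d N \<Longrightarrow> q \<in> bracket_ring d N \<Longrightarrow> p - q \<in> bracket_ring d N"
  using bracket_ring_add[of p d N "- q"] bracket_ring_uminus[of q d N] by simp

lemma bracket_ring_sum: "(\<And>i. i \<in> I \<Longrightarrow> f i \<in> bracket_ring d N) \<Longrightarrow> sum f I \<in> bracket_ring d N"
  by (induction I rule: infinite_finite_induct) (auto intro: bracket_ring_add)

lemma bracket_ring_prod: "(\<And>i. i \<in> I \<Longrightarrow> f i \<in> bracket_ring d N) \<Longrightarrow> prod f I \<in> bracket_ring d N"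
  by (induction I rule: infinite_finite_induct) (auto intro: bracket_ring_mult)

lemma bracket_in_bracket_ring: "length B = d \<Longrightarrow> set B \<subseteq> {..<N} \<Longrightarrow> bracket B \<in> bracket_ring d N"
  by (auto simp: bracket_def basis_indices_def distinct_card intro!: bracket_ring_single)

lemma bracket_idealI: "g \<in> G \<Longrightarrow> a \<in> bracket_ring d N \<Longrightarrow> a * g \<in> bracket_ideal d N G"
  unfolding bracket_ideal_def by (intro CollectI exI[of _ "\<lambda>_. a"] exI[of _ "{g}"]) auto

lemma bracket_ideal_zero: "0 \<in> bracket_ideal d N G"
  unfolding bracket_ideal_def by (intro CollectI exI[of _ "\<lambda>_. 0"] exI[of _ "{}"]) auto

lemma bracket_ideal_add:
  assumes "p \<in> bracket_ideal d N G" "q \<in> bracket_ideal d N G"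
  shows "p + q \<in> bracket_ideal d N G"
proof -
  obtain a H where a: "p = (\<Sum>g\<in>H. a g * g)" "finite H" "H \<subseteq> G" "\<forall>g\<in>H. a g \<in> bracket_ring d N"
    using assms(1) unfolding bracket_ideal_def by blast
  obtain b K where b: "q = (\<Sum>g\<in>K. b g * g)" "finite K" "K \<subseteq> G" "\<forall>g\<in>K. b g \<in> bracket_ring d N"
    using assms(2) unfolding bracket_ideal_def by blast
  define a' where "a' = (\<lambda>g. if g \<in> H then a g else 0)"
  define b' where "b' = (\<lambda>g. if g \<in> K then b g else 0)"
  have "p = (\<Sum>g\<in>H \<union> K. a' g * g)"
    unfolding a(1) by (rule sum.mono_neutral_cong_left) (use a b in \<open>auto simp: a'_def\<close>)
  moreover have "q = (\<Sum>g\<in>H \<union> K. b' g * g)"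
    unfolding b(1) by (rule sum.mono_neutral_cong_left) (use a b in \<open>auto simp: b'_def\<close>)
  ultimately have "p + q = (\<Sum>g\<in>H \<union> K. (a' g + b' g) * g)"
    by (simp add: sum.distrib distrib_right)
  moreover have "\<forall>g\<in>H \<union> K. a' g + b' g \<in> bracket_ring d N"
    using a b by (auto simp: a'_def b'_def intro: bracket_ring_add)
  ultimately show ?thesis
    unfolding bracket_ideal_def using a b
    by (intro CollectI exI[of _ "\<lambda>g. a' g + b' g"] exI[of _ "H \<union> K"]) auto
qed

lemma bracket_ideal_least:
  assumes "0 \<in> I" "\<And>p q. p \<in> I \<Longrightarrow> q \<in> I \<Longrightarrow> p + q \<in> I"
    and "\<And>a g. a \<in> bracket_ring d N \<Longrightarrow> g \<in> G \<Longrightarrow> a * g \<in> I"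
  shows "bracket_ideal d N G \<subseteq> I"
proof
  fix p assume "p \<in> bracket_ideal d N G"
  then obtain a H where a: "p = (\<Sum>g\<in>H. a g * g)" "finite H" "H \<subseteq> G" "\<forall>g\<in>H. a g \<in> bracket_ring d N"
    unfolding bracket_ideal_def by blast
  have "(\<Sum>g\<in>H. a g * g) \<in> I"
    using a(2-4) by (induction H rule: finite_induct) (auto intro: assms)
  with a show "p \<in> I" by simp
qed

lemma eval_poly_bracket_ideal:
  "(\<forall>p\<in>bracket_ideal d N G. eval_poly x p = 0) \<longleftrightarrow> (\<forall>g\<in>G. eval_poly x g = 0)"
proof
  assume *: "\<forall>p\<in>bracket_ideal d N G. eval_poly x p = 0"
  show "\<forall>g\<in>G. eval_poly x g = 0"
    using * bracket_idealI[of _ G 1 d N] by auto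
next
  assume "\<forall>g\<in>G. eval_poly x g = 0"
  then have "bracket_ideal d N G \<subseteq> {p. eval_poly x p = 0}"
    by (intro bracket_ideal_least) (auto simp: eval_poly_add eval_poly_mult)
  then show "\<forall>p\<in>bracket_ideal d N G. eval_poly x p = 0" by blast
qed

lemma zero_set_bracket_ideal: "zero_set d N (bracket_ideal d N G) = zero_set d N G"
  by (simp add: zero_set_def eval_poly_bracket_ideal)

lemma bracket_ideal_Un:
  fixes G H :: "'a::comm_ring_1 bracket_poly set"
  shows "{p + q | p q. p \<in> bracket_ideal d N G \<and> q \<in> bracket_ideal d N H} = bracket_ideal d N (G \<union> H)" (is "?L = ?R")
proof
  have "bracket_ideal d N G \<subseteq> ?R" "bracket_ideal d N H \<subseteq> ?R"
    by (rule bracket_ideal_least; auto intro: bracket_ideal_zero bracket_ideal_add bracket_idealI)+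
  then show "?L \<subseteq> ?R" using bracket_ideal_add by blast
  show "?R \<subseteq> ?L"
  proof (rule bracket_ideal_least)
    show "0 \<in> ?L" using bracket_ideal_zero by (intro CollectI exI[of _ 0]) auto
  next
    fix p q assume "p \<in> ?L" "q \<in> ?L"
    then obtain p1 p2 q1 q2 where "p = p1 + p2" "q = q1 + q2" "p1 \<in> bracket_ideal d N G"
      "q1 \<in> bracket_ideal d N G" "p2 \<in> bracket_ideal d N H" "q2 \<in> bracket_ideal d N H" by blast
    then show "p + q \<in> ?L"
      by (intro CollectI exI[of _ "p1 + q1"] exI[of _ "p2 + q2"]) (auto intro: bracket_ideal_add)
  next
    fix a g :: "'a bracket_poly" assume "a \<in> bracket_ring d N" "g \<in> G \<union> H"
    then consider "a * g \<in> bracket_ideal d N G" | "a * g \<in> bracket_ideal d N H"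
      using bracket_idealI by blast
    then show "a * g \<in> ?L"
    proof cases
      case 1
      then show ?thesis using bracket_ideal_zero by (intro CollectI exI[of _ "a * g"] exI[of _ 0]) auto
    next
      case 2
      then show ?thesis using bracket_ideal_zero by (intro CollectI exI[of _ 0] exI[of _ "a * g"]) auto
    qed
  qed
qed

text \<open>
  Used to replace the generators of \<open>R_ideal\<close>, which are monomials up to sign, by monomials.
\<close>

lemma bracket_ideal_cong_unit:
  assumes "\<And>g. g \<in> G \<Longrightarrow> \<exists>h\<in>H. g = h \<or> g = - h"
  shows "bracket_ideal d N G \<subseteq> bracket_ideal d N H"
proof (rule bracket_ideal_least[OF bracket_ideal_zero bracket_ideal_add])
  fix a g :: "'a bracket_poly" assume a: "a \<in> bracket_ring d N" and "g \<in> G"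
  then obtain h where "h \<in> H" "g = h \<or> g = - h" using assms by blast
  then have "a * g = a * h \<or> a * g = (- a) * h" by auto
  then show "a * g \<in> bracket_ideal d N H"
    using bracket_idealI[OF \<open>h \<in> H\<close>] a bracket_ring_uminus by metis
qed

section \<open>The generators of the ideal\<close>

lemma pairs_below_four: "{(i, j). i < j \<and> j < (4::nat)} = {(0,1), (0,2), (0,3), (1,2), (1,3), (2,3)}"
  by auto

lemma prod_single:
  "finite I \<Longrightarrow> (\<Prod>i\<in>I. Poly_Mapping.single (m i) (c i)) =
    Poly_Mapping.single (\<Sum>i\<in>I. m i) (\<Prod>i\<in>I. c i :: 'a::comm_ring_1)"
  by (induction I rule: finite_induct) (auto simp: mult_single)

lemma R_generator_signed_monomial:
  fixes g :: "'a::comm_ring_1 bracket_poly"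
  assumes "g \<in> R_generators d N"
  shows "\<exists>m. g = Poly_Mapping.single m 1 \<or> g = - Poly_Mapping.single m 1"
proof -
  let ?I = "{(i, j). i < j \<and> j < (4::nat)}"
  obtain B p where g: "g = (\<Prod>(i, j) \<in> ?I. bracket (B @ [p ! i, p ! j]))"
    and Bp: "length p = 4" "distinct (B @ p)"
    using assms unfolding R_generators_def by blast
  let ?L = "\<lambda>q. B @ [p ! fst q, p ! snd q]"
  have fin: "finite ?I" unfolding pairs_below_four by simp
  have "g = (\<Prod>q\<in>?I. Poly_Mapping.single (Poly_Mapping.single (set (?L q)) 1) ((-1) ^ inversions (?L q)))"
    unfolding g
  proof (rule prod.cong[OF HOL.refl], clarify)
    fix i j :: nat assume ij: "i < j" "j < 4"
    then have "p ! i \<in> set p" "p ! j \<in> set p" "p ! i \<noteq> p ! j"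
      using Bp by (auto simp: nth_eq_iff_index_eq)
    then have "distinct (?L (i, j))" using Bp by auto
    then show "bracket (B @ [p ! i, p ! j]) = Poly_Mapping.single (Poly_Mapping.single (set (?L (i, j))) 1) ((-1) ^ inversions (?L (i, j)))"
      by (simp add: bracket_def inversions_def)
  qed
  also have "\<dots> = Poly_Mapping.single (\<Sum>q\<in>?I. Poly_Mapping.single (set (?L q)) 1) ((-1) ^ (\<Sum>q\<in>?I. inversions (?L q)))"
    by (simp only: prod_single[OF fin] power_sum)
  finally obtain m n where gm: "g = Poly_Mapping.single m ((-1) ^ n)" by blast
  have "(-1) ^ n = (1::'a) \<or> (-1) ^ n = (- 1::'a)" by (cases "even n") auto
  then have "g = Poly_Mapping.single m 1 \<or> g = - Poly_Mapping.single m 1"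
    unfolding gm by (elim disjE; simp only: single_uminus; simp)
  then show ?thesis ..
qed

lemma R_generator_in_bracket_ring:
  fixes g :: "'a::comm_ring_1 bracket_poly"
  assumes "g \<in> R_generators d N"
  shows "g \<in> bracket_ring d N"
proof -
  obtain B p where g: "g = (\<Prod>(i, j) \<in> {(i, j). i < j \<and> j < 4}. bracket (B @ [p ! i, p ! j]))"
    and Bp: "length B + 2 = d" "length p = 4" "set (B @ p) \<subseteq> {..<N}"
    using assms unfolding R_generators_def by blast
  have "bracket (B @ [p ! i, p ! j]) \<in> (bracket_ring d N :: 'a bracket_poly set)" if "i < j" "j < 4" for i j
  proof (rule bracket_in_bracket_ring)
    have "p ! i \<in> set p" "p ! j \<in> set p" using Bp that by auto
    then show "set (B @ [p ! i, p ! j]) \<subseteq> {..<N}" using Bp by auto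
  qed (use Bp in auto)
  then show ?thesis unfolding g by (intro bracket_ring_prod) auto
qed

lemma R_generator_homogeneous:
  assumes "g \<in> R_generators d N"
  shows "homogeneous 6 g"
proof -
  let ?I = "{(i, j). i < j \<and> j < (4::nat)}"
  obtain B p where g: "g = (\<Prod>(i, j) \<in> ?I. bracket (B @ [p ! i, p ! j]))"
    using assms unfolding R_generators_def by blast
  have "finite ?I" "card ?I = 6" unfolding pairs_below_four by simp_all
  then show ?thesis
    unfolding g using homogeneous_prod[of ?I "\<lambda>(i, j). bracket (B @ [p ! i, p ! j])"] homogeneous_bracket by auto
qed

lemma plucker_relation_in_bracket_ring:
  fixes g :: "'a::comm_ring_1 bracket_poly"
  assumes "g \<in> plucker_relations d N"
  shows "g \<in> bracket_ring d N"
proof -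
  obtain b B B' where g: "g = bracket (b # B) * bracket B' - (\<Sum>i<d. bracket (B' ! i # B) * bracket (B'[i := b]))"
    and len: "length (b # B) = d" "length B' = d" and sub: "set (b # B) \<subseteq> {..<N}" "set B' \<subseteq> {..<N}"
    using assms unfolding plucker_relations_def by blast
  have "bracket (B' ! i # B) \<in> (bracket_ring d N :: 'a bracket_poly set)"
    "bracket (B'[i := b]) \<in> (bracket_ring d N :: 'a bracket_poly set)" if "i < d" for i
    using len sub that nth_mem[of i B'] set_update_subset_insert[of B' i b]
    by (intro bracket_in_bracket_ring; force)+
  then have "(\<Sum>i<d. bracket (B' ! i # B) * bracket (B'[i := b])) \<in> (bracket_ring d N :: 'a bracket_poly set)"
    by (intro bracket_ring_sum bracket_ring_mult) auto
  moreover have "bracket (b # B) * bracket B' \<in> (bracket_ring d N :: 'a bracket_poly set)"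
    by (intro bracket_ring_mult bracket_in_bracket_ring len sub)
  ultimately show ?thesis unfolding g by (intro bracket_ring_diff)
qed

lemma plucker_relation_homogeneous:
  fixes g :: "'a::comm_ring_1 bracket_poly"
  assumes "g \<in> plucker_relations d N"
  shows "homogeneous 2 g"
proof -
  have "homogeneous 2 (bracket B * bracket B' :: 'a bracket_poly)" for B B'
    using homogeneous_mult[OF homogeneous_bracket homogeneous_bracket, of B B'] by (simp add: numeral_2_eq_2)
  then show ?thesis using assms unfolding plucker_relations_def
    by (auto intro!: homogeneous_diff homogeneous_sum)
qed

lemma eval_plucker_relations:
  fixes x :: "nat set \<Rightarrow> 'a::comm_ring_1"
  shows "(\<forall>g\<in>plucker_relations d N. eval_poly x g = 0) \<longleftrightarrow>
   (\<forall>b B B'. length (b # B) = d \<longrightarrow> length B' = d \<longrightarrow> set (b # B) \<subseteq> {..<N} \<longrightarrow> set B' \<subseteq> {..<N} \<longrightarrow>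
      bracket_value x (b # B) * bracket_value x B' =
        (\<Sum>i<d. bracket_value x (B' ! i # B) * bracket_value x (B'[i := b])))"
proof -
  have eval: "eval_poly x (bracket (b # B) * bracket B' - (\<Sum>i<d. bracket (B' ! i # B) * bracket (B'[i := b]))) =
    bracket_value x (b # B) * bracket_value x B' -
      (\<Sum>i<d. bracket_value x (B' ! i # B) * bracket_value x (B'[i := b]))" for b B B'
    by (simp add: eval_poly_diff eval_poly_mult eval_poly_sum eval_poly_bracket)
  show ?thesis (is "?L \<longleftrightarrow> ?R")
  proof
    assume L: ?L
    show ?R
    proof (intro allI impI)
      fix b B B' assume "length (b # B) = d" "length B' = d" "set (b # B) \<subseteq> {..<N}" "set B' \<subseteq> {..<N}"
      then have "bracket (b # B) * bracket B' - (\<Sum>i<d. bracket (B' ! i # B) * bracket (B'[i := b]))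
          \<in> (plucker_relations d N :: 'a bracket_poly set)"
        unfolding plucker_relations_def by blast
      with L have "eval_poly x (bracket (b # B) * bracket B' -
          (\<Sum>i<d. bracket (B' ! i # B) * bracket (B'[i := b]))) = 0" by blast
      then show "bracket_value x (b # B) * bracket_value x B' =
          (\<Sum>i<d. bracket_value x (B' ! i # B) * bracket_value x (B'[i := b]))"
        unfolding eval by simp
    qed
  next
    assume R: ?R
    show ?L
    proof
      fix g :: "'a bracket_poly" assume "g \<in> plucker_relations d N"
      then obtain b B B' where g: "g = bracket (b # B) * bracket B' -
          (\<Sum>i<d. bracket (B' ! i # B) * bracket (B'[i := b]))"
        and "length (b # B) = d" "length B' = d" "set (b # B) \<subseteq> {..<N}" "set B' \<subseteq> {..<N}"
        unfolding plucker_relations_def by blast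
      then have "bracket_value x (b # B) * bracket_value x B' =
          (\<Sum>i<d. bracket_value x (B' ! i # B) * bracket_value x (B'[i := b]))" using R by blast
      then show "eval_poly x g = 0" unfolding g eval by simp
    qed
  qed
qed

section \<open>Bases and minors\<close>

lemma column_matroid_class_ring:
  fixes A :: "'a::field mat"
  shows "J \<in> column_matroid class_ring A \<longleftrightarrow> J \<subseteq> {..<dim_col A} \<and>
    (\<forall>c. (\<forall>i<dim_row A. (\<Sum>j\<in>J. A $$ (i, j) * c j) = 0) \<longrightarrow> (\<forall>j\<in>J. c j = 0))"
  by (auto simp: column_matroid_def class_ring_simps)

text \<open>
  The matrix of the columns \<open>T\<close> is padded with zero rows to make it square, which also covers the
  case of more than \<open>d\<close> columns.
\<close>

lemma columns_independent_iff_det: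
  fixes X :: "'a::field mat"
  assumes X: "X \<in> carrier_mat d N" and T: "length T = n" "distinct T" "set T \<subseteq> {..<N}" and dn: "d \<le> n"
  shows "set T \<in> column_matroid class_ring X \<longleftrightarrow>
    det (mat n n (\<lambda>(i, j). if i < d then X $$ (i, T ! j) else 0)) \<noteq> 0"
proof -
  let ?M = "mat n n (\<lambda>(i, j). if i < d then X $$ (i, T ! j) else 0)"
  have bij: "bij_betw (nth T) {..<n} (set T)" using bij_betw_nth[OF T(2)] T(1) by simp
  have reindex: "(\<Sum>j\<in>set T. X $$ (i, j) * c j) = (\<Sum>k<n. X $$ (i, T ! k) * c (T ! k))" for i c
    by (rule sum.reindex_bij_betw[OF bij, symmetric])
  have ker: "?M *\<^sub>v v = 0\<^sub>v n \<longleftrightarrow> (\<forall>i<d. (\<Sum>k<n. X $$ (i, T ! k) * v $ k) = 0)"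
    if v: "v \<in> carrier_vec n" for v
  proof -
    have entry: "(?M *\<^sub>v v) $ i = (if i < d then \<Sum>k<n. X $$ (i, T ! k) * v $ k else 0)" if "i < n" for i
      using v that by (auto simp: scalar_prod_def atLeast0LessThan)
    have "?M *\<^sub>v v = 0\<^sub>v n \<longleftrightarrow> (\<forall>i<n. (?M *\<^sub>v v) $ i = 0)"
      by (auto simp: vec_eq_iff)
    also have "\<dots> \<longleftrightarrow> (\<forall>i<n. i < d \<longrightarrow> (\<Sum>k<n. X $$ (i, T ! k) * v $ k) = 0)"
      by (simp add: entry del: index_mult_mat_vec, blast)
    also have "\<dots> \<longleftrightarrow> (\<forall>i<d. (\<Sum>k<n. X $$ (i, T ! k) * v $ k) = 0)"
      using dn less_le_trans by blast
    finally show ?thesis .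
  qed
  show ?thesis
  proof
    assume L: "set T \<in> column_matroid class_ring X"
    show "det ?M \<noteq> 0"
    proof
      assume "det ?M = 0"
      then obtain v where v: "v \<in> carrier_vec n" "v \<noteq> 0\<^sub>v n" "?M *\<^sub>v v = 0\<^sub>v n"
        using det_0_iff_vec_prod_zero_field[of ?M n] by auto
      define c where "c = (\<lambda>j. v $ the_inv_into {..<n} (nth T) j)"
      have c: "c (T ! k) = v $ k" if "k < n" for k
        using the_inv_into_f_f[OF bij_betw_imp_inj_on[OF bij], of k] that by (simp add: c_def)
      have "\<forall>i<dim_row X. (\<Sum>j\<in>set T. X $$ (i, j) * c j) = 0"
        using ker[OF v(1)] v(3) X c by (auto simp: reindex)
      then have "\<forall>j\<in>set T. c j = 0" using L unfolding column_matroid_class_ring by blast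
      then have "v $ k = 0" if "k < n" for k using c[OF that] that T(1) by auto
      then have "v = 0\<^sub>v n" using v(1) by auto
      with v(2) show False by blast
    qed
  next
    assume D: "det ?M \<noteq> 0"
    have "\<forall>j\<in>set T. c j = 0" if c: "\<forall>i<dim_row X. (\<Sum>j\<in>set T. X $$ (i, j) * c j) = 0" for c
    proof -
      let ?v = "vec n (\<lambda>k. c (T ! k))"
      have "?M *\<^sub>v ?v = 0\<^sub>v n" using c X by (subst ker) (auto simp: reindex)
      moreover have "\<nexists>v. v \<in> carrier_vec n \<and> v \<noteq> 0\<^sub>v n \<and> ?M *\<^sub>v v = 0\<^sub>v n"
        using D det_0_iff_vec_prod_zero_field[of ?M n] by simp
      ultimately have "?v = 0\<^sub>v n" using vec_carrier by blast
      then have "c (T ! k) = 0" if "k < n" for k using that by (metis index_vec index_zero_vec(1))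
      then show ?thesis using T(1) by (auto simp: in_set_conv_nth)
    qed
    then show "set T \<in> column_matroid class_ring X"
      using T(3) X unfolding column_matroid_class_ring by auto
  qed
qed

lemma basis_iff_wedge_rows:
  fixes X :: "'a::field mat"
  assumes X: "X \<in> carrier_mat d N" and S: "S \<in> basis_indices d N"
  shows "S \<in> column_matroid class_ring X \<longleftrightarrow> wedge_rows d N X S \<noteq> 0"
proof -
  have fin: "finite S" using S finite_subset[of S "{..<N}"] by (auto simp: basis_indices_def)
  let ?T = "sorted_list_of_set S"
  have "mat d d (\<lambda>(i, j). if i < d then X $$ (i, ?T ! j) else 0) = mat d d (\<lambda>(i, j). X $$ (i, ?T ! j))"
    by (rule eq_matI) auto
  then show ?thesis
    using columns_independent_iff_det[OF X, of ?T d] S fin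
    by (simp add: wedge_rows_eq_columns_det[OF X S] columns_det_def basis_indices_def)
qed

lemma independent_card_le:
  fixes X :: "'a::field mat"
  assumes X: "X \<in> carrier_mat d N" and J: "J \<in> column_matroid class_ring X"
  shows "card J \<le> d"
proof (rule ccontr)
  assume "\<not> card J \<le> d"
  then have d: "d < card J" by simp
  have JN: "J \<subseteq> {..<N}" using J X unfolding column_matroid_class_ring by auto
  then have fin: "finite J" by (rule finite_subset) simp
  let ?M = "mat (card J) (card J) (\<lambda>(i, j). if i < d then X $$ (i, sorted_list_of_set J ! j) else 0)"
  have "det ?M = (\<Sum>j<card J. ?M $$ (d, j) * cofactor ?M d j)"
    by (rule laplace_expansion_row) (use d in auto)
  also have "\<dots> = 0" by (rule sum.neutral) (use d in auto)
  finally show False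
    using columns_independent_iff_det[OF X, of "sorted_list_of_set J" "card J"] J JN fin d by simp
qed

lemma kernel_pivot:
  fixes A :: "nat \<Rightarrow> nat \<Rightarrow> 'a::field"
  assumes "r < d" "A r f \<noteq> 0"
  shows "(\<forall>i<d. (\<Sum>j<N. pivot r f A i j * c j) = 0) \<longleftrightarrow> (\<forall>i<d. (\<Sum>j<N. A i j * c j) = 0)"
proof -
  let ?S = "\<lambda>i. \<Sum>j<N. A i j * c j" and ?S' = "\<lambda>i. \<Sum>j<N. pivot r f A i j * c j"
  have r: "?S' r = ?S r / A r f"
    unfolding sum_divide_distrib by (rule sum.cong) (auto simp: pivot_def)
  have i: "?S' i = ?S i - A i f / A r f * ?S r" if "i \<noteq> r" for i
    unfolding sum_distrib_left sum_subtractf[symmetric]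
    by (rule sum.cong) (use that in \<open>auto simp: pivot_def algebra_simps\<close>)
  have "?S' r = 0 \<longleftrightarrow> ?S r = 0" using r assms by simp
  moreover have "?S' i = ?S i" if "?S r = 0" "i < d" for i
    using r i[of i] that by (cases "i = r") simp_all
  ultimately show ?thesis using assms(1) by metis
qed

lemma kernel_reaches:
  assumes "reaches d N A b A' b'"
  shows "(\<forall>i<d. (\<Sum>j<N. A' i j * c j) = 0) \<longleftrightarrow> (\<forall>i<d. (\<Sum>j<N. A i j * c j) = 0)"
  using assms by (induction rule: reaches.induct) (simp_all add: kernel_pivot)

text \<open>
  Pivoting does not change the kernel of the matrix, and at the end the basis columns are unit
  vectors.
\<close>

lemma reaches_basis_independent:
  fixes X :: "'a::field mat"
  assumes X: "X \<in> carrier_mat d N" and tab: "is_tableau d N (\<lambda>i j. X $$ (i, j)) b"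
    and R: "reaches d N (\<lambda>i j. X $$ (i, j)) b A' b'"
  shows "b' ` {..<d} \<in> column_matroid class_ring X"
proof -
  have tab': "is_tableau d N A' b'" by (rule is_tableau_reaches[OF R tab])
  have sub: "b' ` {..<d} \<subseteq> {..<N}" using is_tableau_basis_less[OF tab'] by auto
  have "\<forall>j\<in>b' ` {..<d}. c j = 0"
    if c: "\<forall>i<d. (\<Sum>j\<in>b' ` {..<d}. X $$ (i, j) * c j) = 0" for c
  proof -
    define c' where "c' = (\<lambda>j. if j \<in> b' ` {..<d} then c j else 0)"
    have "(\<Sum>j<N. X $$ (i, j) * c' j) = (\<Sum>j\<in>b' ` {..<d}. X $$ (i, j) * c j)" for i
      by (rule sum.mono_neutral_cong_right) (use sub in \<open>auto simp: c'_def\<close>)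
    then have "\<forall>i<d. (\<Sum>j<N. X $$ (i, j) * c' j) = 0" using c by simp
    then have ker: "\<forall>i<d. (\<Sum>j<N. A' i j * c' j) = 0" using kernel_reaches[OF R] by blast
    have "c' (b' i) = 0" if i: "i < d" for i
    proof -
      have "(\<Sum>j<N. A' i j * c' j) = (\<Sum>j\<in>{b' i}. A' i j * c' j)"
      proof (rule sum.mono_neutral_right)
        show "\<forall>j\<in>{..<N} - {b' i}. A' i j * c' j = 0"
          using is_tableau_unit[OF tab' _ i] by (auto simp: c'_def)
      qed (use is_tableau_basis_less[OF tab' i] in auto)
      then show ?thesis using ker i is_tableau_unit[OF tab' i i] by simp
    qed
    then show ?thesis by (auto simp: c'_def)
  qed
  then show ?thesis using sub X unfolding column_matroid_class_ring by auto
qed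

lemma column_matroid_rescale:
  fixes X :: "'a::field mat"
  assumes X: "X \<in> carrier_mat d N" and t: "\<And>e. t e \<noteq> 0"
  shows "column_matroid class_ring (mat d N (\<lambda>(i, j). rescale t b (\<lambda>i j. X $$ (i, j)) i j)) =
    column_matroid class_ring X" (is "column_matroid _ ?Y = _")
proof (rule Set.set_eqI)
  fix J
  show "J \<in> column_matroid class_ring ?Y \<longleftrightarrow> J \<in> column_matroid class_ring X"
  proof (cases "J \<subseteq> {..<N}")
    case J: True
    have eq: "(\<Sum>j\<in>J. ?Y $$ (i, j) * c j) = (\<Sum>j\<in>J. X $$ (i, j) * (t j * c j)) / t (b i)" if "i < d" for i c
      unfolding sum_divide_distrib by (rule sum.cong) (use that J in \<open>auto simp: rescale_def\<close>)
    have ker: "(\<forall>i<d. (\<Sum>j\<in>J. ?Y $$ (i, j) * c j) = 0) \<longleftrightarrow> (\<forall>i<d. (\<Sum>j\<in>J. X $$ (i, j) * (t j * c j)) = 0)" for c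
      using eq t by simp
    have "(\<forall>c. (\<forall>i<d. (\<Sum>j\<in>J. X $$ (i, j) * (t j * c j)) = 0) \<longrightarrow> (\<forall>j\<in>J. c j = 0)) \<longleftrightarrow>
      (\<forall>c. (\<forall>i<d. (\<Sum>j\<in>J. X $$ (i, j) * c j) = 0) \<longrightarrow> (\<forall>j\<in>J. c j = 0))" (is "?A \<longleftrightarrow> ?B")
    proof
      assume A: ?A
      show ?B
      proof (intro allI impI)
        fix c assume "\<forall>i<d. (\<Sum>j\<in>J. X $$ (i, j) * c j) = 0"
        then have "\<forall>j\<in>J. c j / t j = 0" using A[rule_format, of "\<lambda>j. c j / t j"] t by simp
        then show "\<forall>j\<in>J. c j = 0" using t by simp
      qed
    next
      assume B: ?B
      show ?A
      proof (intro allI impI)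
        fix c assume "\<forall>i<d. (\<Sum>j\<in>J. X $$ (i, j) * (t j * c j)) = 0"
        then have "\<forall>j\<in>J. t j * c j = 0" using B[THEN spec, of "\<lambda>j. t j * c j"] by (rule rev_mp)
        then show "\<forall>j\<in>J. c j = 0" using t by simp
      qed
    qed
    moreover have "dim_row ?Y = d" "dim_col ?Y = N" "dim_row X = d" "dim_col X = N" using X by auto
    ultimately show ?thesis by (simp only: column_matroid_class_ring ker)
  qed (use X in \<open>auto simp: column_matroid_class_ring\<close>)
qed

section \<open>The regular Grassmannian as a zero set\<close>

lemma regular_if_no_four_point_line:
  fixes X :: "'a::field_char_0 mat"
  assumes X: "X \<in> carrier_mat d N" and tab: "is_tableau d N (\<lambda>i j. X $$ (i, j)) b"
    and no_line: "\<And>B p. card B + 2 = d \<Longrightarrow> B \<subseteq> {..<N} \<Longrightarrow> p ` {..<4} \<subseteq> {..<N} - B \<Longrightarrow>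
      inj_on p {..<4::nat} \<Longrightarrow> \<exists>i j. i < j \<and> j < 4 \<and> wedge_rows d N X (B \<union> {p i, p j}) = 0"
  shows "regular_matroid TYPE('u) N (column_matroid class_ring X)"
proof -
  let ?A = "\<lambda>i j. X $$ (i, j)"
  have "stably_proportional d N ?A b"
  proof (rule stably_proportional_if_no_four_point_line[OF tab, of "{S. wedge_rows d N X S \<noteq> 0}"])
    fix A' b' assume R: "reaches d N ?A b A' b'"
    have tab': "is_tableau d N A' b'" by (rule is_tableau_reaches[OF R tab])
    have "b' ` {..<d} \<in> basis_indices d N"
      using is_tableau_basis_less[OF tab'] card_image[OF is_tableau_inj[OF tab']]
      by (auto simp: basis_indices_def)
    then show "b' ` {..<d} \<in> {S. wedge_rows d N X S \<noteq> 0}"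
      using basis_iff_wedge_rows[OF X] reaches_basis_independent[OF X tab R] by blast
  qed (use no_line in auto)
  then obtain t where t: "\<And>e. t e \<noteq> 0" and sg: "signs_on {..<N} d (rescale t b ?A)"
    using exists_sign_rescaling[OF tab] by blast
  have sp': "stably_proportional d N (rescale t b ?A) b"
    by (rule stably_proportional_rescale[OF t \<open>stably_proportional d N ?A b\<close>])
  have tab': "is_tableau d N (rescale t b ?A) b" by (rule is_tableau_rescale[OF t tab])
  have signs: "mat d N (\<lambda>(i, j). sign_in (class_ring :: 'a ring) (rescale t b ?A i j)) = mat d N (\<lambda>(i, j). rescale t b ?A i j)"
  proof (rule eq_matI; clarsimp)
    fix i j assume "i < d" "j < N"
    then have "rescale t b ?A i j \<in> {0, 1, -1}" using sg unfolding signs_on_def by blast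
    then show "sign_in class_ring (rescale t b ?A i j) = rescale t b ?A i j"
      by (auto simp: sign_in_def class_ring_simps)
  qed
  have "column_matroid class_ring X =
      column_matroid class_ring (mat d N (\<lambda>(i, j). sign_in (class_ring :: 'a ring) (rescale t b ?A i j)))"
    unfolding signs by (rule column_matroid_rescale[of X d N t b, OF X t, symmetric])
  also have "\<dots> = {J. J \<subseteq> {..<N} \<and> (\<exists>A' b'. reaches d N (rescale t b ?A) b A' b' \<and> J \<subseteq> b' ` {..<d})}"
    by (rule field.column_matroid_sign_tableau[OF class_field tab' sp' sg])
  finally show ?thesis using regular_matroid_sign_tableau[OF tab' sp' sg] by simp
qed

text \<open>
  If no factor were zero, the six pairs would give independent sets, while a triple always gives a
  dependent one because it makes \<open>d + 1\<close> columns with \<open>d\<close> rows.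
\<close>

lemma four_point_line_zero_if_regular:
  fixes X :: "'a::field mat"
  assumes X: "X \<in> carrier_mat d N" and "infinite (UNIV :: 'u set)"
    and reg: "regular_matroid TYPE('u) N (column_matroid class_ring X)"
    and B: "length B + 2 = d" "length p = 4" "distinct (B @ p)" "set (B @ p) \<subseteq> {..<N}"
  shows "\<exists>i j. i < j \<and> j < 4 \<and> wedge_rows d N X (set (B @ [p ! i, p ! j])) = 0"
proof (rule ccontr)
  assume nz: "\<not> (\<exists>i j. i < j \<and> j < 4 \<and> wedge_rows d N X (set (B @ [p ! i, p ! j])) = 0)"
  obtain v w x y where p: "p = [v, w, x, y]"
    using B(2) by (auto simp: length_Suc_conv eval_nat_numeral)
  let ?C = "column_matroid class_ring X"
  have pair: "set B \<union> {p ! i, p ! j} \<in> ?C" if "i < j" "j < 4" for i j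
  proof -
    have "p ! i \<noteq> p ! j" "p ! i \<in> set p" "p ! j \<in> set p"
      using B that by (auto simp: nth_eq_iff_index_eq)
    then have "distinct (B @ [p ! i, p ! j])" "set (B @ [p ! i, p ! j]) \<subseteq> {..<N}" using B by auto
    then have "set (B @ [p ! i, p ! j]) \<in> basis_indices d N"
      using B(1) distinct_card[of "B @ [p ! i, p ! j]"] by (simp add: basis_indices_def)
    then have "set (B @ [p ! i, p ! j]) \<in> ?C" using basis_iff_wedge_rows[OF X] nz that by blast
    then show ?thesis by simp
  qed
  have triple: "set B \<union> {a, b, c} \<notin> ?C" if "distinct (B @ [a, b, c])" for a b c
  proof
    assume "set B \<union> {a, b, c} \<in> ?C"
    then have "card (set B \<union> {a, b, c}) \<le> d" by (rule independent_card_le[OF X])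
    moreover have "card (set (B @ [a, b, c])) = d + 1" using distinct_card[OF that] B(1) by simp
    ultimately show False by simp
  qed
  show False
  proof (rule regular_matroid_no_four_point_line[OF assms(2) reg, of v w x y "set B"])
    show "distinct [v, w, x, y]" "{v, w, x, y} \<subseteq> {..<N} - set B" using B p by auto
    show "set B \<union> {v, w} \<in> ?C" "set B \<union> {v, x} \<in> ?C" "set B \<union> {v, y} \<in> ?C"
      "set B \<union> {w, x} \<in> ?C" "set B \<union> {w, y} \<in> ?C" "set B \<union> {x, y} \<in> ?C"
      using pair[of 0 1] pair[of 0 2] pair[of 0 3] pair[of 1 2] pair[of 1 3] pair[of 2 3]
      by (simp_all add: p numeral_2_eq_2 numeral_3_eq_3)
    show "set B \<union> {v, w, x} \<notin> ?C" "set B \<union> {v, w, y} \<notin> ?C"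
      by (rule triple; use B p in auto)+
  qed
qed

lemma scaling_class_eq:
  assumes "x \<in> exterior_power d N" "c \<noteq> 0" "y = (\<lambda>S. c * x S)" "x \<noteq> (\<lambda>_. 0)"
  shows "scaling_rel d N `` {y} = scaling_rel d N `` {x}" "y \<in> scaling_rel d N `` {x}"
proof -
  have y: "y \<in> exterior_power d N - {\<lambda>_. 0}" using assms by (auto simp: exterior_power_def fun_eq_iff)
  show "y \<in> scaling_rel d N `` {x}" using y assms by (auto simp: scaling_rel_def)
  have 1: "\<exists>k. k \<noteq> 0 \<and> z = (\<lambda>S. k * x S)" if "e \<noteq> 0" "z = (\<lambda>S. e * y S)" for z e
    unfolding that(2) assms(3) using that(1) assms(2) by (intro exI[of _ "e * c"]) (simp add: mult.assoc)
  have 2: "\<exists>k. k \<noteq> 0 \<and> z = (\<lambda>S. k * y S)" if "e \<noteq> 0" "z = (\<lambda>S. e * x S)" for z e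
    unfolding that(2) assms(3) using that(1) assms(2) by (intro exI[of _ "e / c"]) (simp flip: mult.assoc)
  show "scaling_rel d N `` {y} = scaling_rel d N `` {x}"
  proof (rule Set.set_eqI)
    fix z
    have "(\<exists>k. k \<noteq> 0 \<and> z = (\<lambda>S. k * y S)) \<longleftrightarrow> (\<exists>k. k \<noteq> 0 \<and> z = (\<lambda>S. k * x S))"
      using 1[of _ z] 2[of _ z] by blast
    then show "z \<in> scaling_rel d N `` {y} \<longleftrightarrow> z \<in> scaling_rel d N `` {x}"
      using y assms(1,4) unfolding scaling_rel_def by simp
  qed
qed

lemma wedge_rows_in_exterior_power: "wedge_rows d N X \<in> exterior_power d N"
  by (auto simp: wedge_rows_def exterior_power_def)

lemma R_generators_zero_iff:
  fixes x :: "nat set \<Rightarrow> 'a::field"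
  shows "(\<forall>g\<in>R_generators d N. eval_poly x g = 0) \<longleftrightarrow>
    (\<forall>B p. length B + 2 = d \<longrightarrow> length p = 4 \<longrightarrow> distinct (B @ p) \<longrightarrow> set (B @ p) \<subseteq> {..<N} \<longrightarrow>
      (\<exists>i j. i < j \<and> j < 4 \<and> x (set (B @ [p ! i, p ! j])) = 0))"
proof -
  have eval: "eval_poly x (\<Prod>(i, j) \<in> {(i, j). i < j \<and> j < 4}. bracket (B @ [p ! i, p ! j])) = 0 \<longleftrightarrow>
    (\<exists>i j. i < j \<and> j < 4 \<and> x (set (B @ [p ! i, p ! j])) = 0)"
    if "length p = 4" "distinct (B @ p)" for B p
  proof -
    have dist: "distinct (B @ [p ! i, p ! j])" if "i < j" "j < 4" for i j
    proof -
      have "p ! i \<noteq> p ! j" "p ! i \<in> set p" "p ! j \<in> set p"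
        using \<open>length p = 4\<close> \<open>distinct (B @ p)\<close> that by (auto simp: nth_eq_iff_index_eq)
      then show ?thesis using \<open>distinct (B @ p)\<close> by auto
    qed
    have "finite {(i, j). i < j \<and> j < (4::nat)}" unfolding pairs_below_four by simp
    then have "eval_poly x (\<Prod>(i, j) \<in> {(i, j). i < j \<and> j < 4}. bracket (B @ [p ! i, p ! j])) = 0 \<longleftrightarrow>
      (\<exists>i j. i < j \<and> j < 4 \<and> bracket_value x (B @ [p ! i, p ! j]) = 0)"
      by (auto simp: eval_poly_prod eval_poly_bracket case_prod_unfold)
    also have "\<dots> \<longleftrightarrow> (\<exists>i j. i < j \<and> j < 4 \<and> x (set (B @ [p ! i, p ! j])) = 0)"
      using dist by (auto simp: bracket_value_def)
    finally show ?thesis .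
  qed
  show ?thesis (is "?L \<longleftrightarrow> ?R")
  proof
    assume L: ?L
    show ?R
    proof (intro allI impI)
      fix B p :: "nat list" assume Bp: "length B + 2 = d" "length p = 4" "distinct (B @ p)" "set (B @ p) \<subseteq> {..<N}"
      then have "(\<Prod>(i, j) \<in> {(i, j). i < j \<and> j < 4}. bracket (B @ [p ! i, p ! j])) \<in>
        (R_generators d N :: 'a bracket_poly set)" unfolding R_generators_def by blast
      then have "eval_poly x (\<Prod>(i, j) \<in> {(i, j). i < j \<and> j < 4}. bracket (B @ [p ! i, p ! j])) = 0"
        using L by blast
      then show "\<exists>i j. i < j \<and> j < 4 \<and> x (set (B @ [p ! i, p ! j])) = 0"
        unfolding eval[OF Bp(2,3)] .
    qed
  next
    assume R: ?R
    show ?L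
    proof
      fix g :: "'a bracket_poly" assume "g \<in> R_generators d N"
      then obtain B p where g: "g = (\<Prod>(i, j) \<in> {(i, j). i < j \<and> j < 4}. bracket (B @ [p ! i, p ! j]))"
        and Bp: "length B + 2 = d" "length p = 4" "distinct (B @ p)" "set (B @ p) \<subseteq> {..<N}"
        unfolding R_generators_def by blast
      show "eval_poly x g = 0" unfolding g eval[OF Bp(2,3)] using R Bp by blast
    qed
  qed
qed

text \<open>
  By homogeneity it suffices to evaluate the generators at the minors of the representing matrix.
\<close>

lemma regular_grassmannian_subset_zero_set:
  assumes inf: "infinite (UNIV :: 'u set)"
  shows "regular_grassmannian TYPE('u) d N \<subseteq>
    (zero_set d N (plucker_relations d N \<union> R_generators d N) :: (nat set \<Rightarrow> 'a::field_char_0) set set)"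
proof
  fix P :: "(nat set \<Rightarrow> 'a) set" assume "P \<in> regular_grassmannian TYPE('u) d N"
  then obtain X0 X where P: "P = scaling_rel d N `` {wedge_rows d N X0}" and nz: "wedge_rows d N X0 \<noteq> (\<lambda>_. 0)"
    and X: "X \<in> carrier_mat d N" "wedge_rows d N X \<in> P"
    and reg: "regular_matroid TYPE('u) N (column_matroid class_ring X)"
    unfolding regular_grassmannian_def grassmannian_def by blast
  let ?w = "wedge_rows d N X"
  have "P \<in> proj_exterior_power d N"
    unfolding P proj_exterior_power_def
    by (rule quotientI) (use nz wedge_rows_in_exterior_power in auto)
  moreover have "eval_poly x g = 0" if x: "x \<in> P" and g: "g \<in> plucker_relations d N \<union> R_generators d N" for x g
  proof -
    obtain a where a: "a \<noteq> 0" "x = (\<lambda>S. a * wedge_rows d N X0 S)" using x unfolding P scaling_rel_def by blast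
    obtain e where e: "e \<noteq> 0" "?w = (\<lambda>S. e * wedge_rows d N X0 S)" using X(2) unfolding P scaling_rel_def by blast
    have xw: "x = (\<lambda>S. (a / e) * ?w S)" using a e by (auto simp: fun_eq_iff)
    obtain k where k: "homogeneous k g"
      using g plucker_relation_homogeneous R_generator_homogeneous by blast
    have "\<forall>g\<in>plucker_relations d N. eval_poly ?w g = 0"
      unfolding eval_plucker_relations
    proof (intro allI impI)
      fix b and B B' :: "nat list" assume len: "length (b # B) = d" "length B' = d" and sub: "set (b # B) \<subseteq> {..<N}" "set B' \<subseteq> {..<N}"
      have "set (B' ! i # B) \<subseteq> {..<N}" "set (B'[i := b]) \<subseteq> {..<N}" if "i < d" for i
        using that len sub nth_mem[of i B'] set_update_subset_insert[of B' i b] by fastforce+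
      then show "bracket_value ?w (b # B) * bracket_value ?w B' =
        (\<Sum>i<d. bracket_value ?w (B' ! i # B) * bracket_value ?w (B'[i := b]))"
        using columns_det_exchange[OF len, of X] len sub
        by (simp add: columns_det_eq_bracket_value[OF X(1)])
    qed
    moreover have "\<forall>g\<in>R_generators d N. eval_poly ?w g = 0"
      unfolding R_generators_zero_iff using four_point_line_zero_if_regular[OF X(1) inf reg] by blast
    ultimately have "eval_poly ?w g = 0" using g by blast
    then show ?thesis unfolding xw eval_poly_scale[OF k] by simp
  qed
  ultimately show "P \<in> zero_set d N (plucker_relations d N \<union> R_generators d N)"
    unfolding zero_set_def by blast
qed

lemma zero_set_subset_regular_grassmannian:
  "(zero_set d N (plucker_relations d N \<union> R_generators d N) :: (nat set \<Rightarrow> 'a::field_char_0) set set)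
    \<subseteq> regular_grassmannian TYPE('u) d N"
proof
  fix P :: "(nat set \<Rightarrow> 'a) set" assume "P \<in> zero_set d N (plucker_relations d N \<union> R_generators d N)"
  then have "P \<in> proj_exterior_power d N"
    and zero: "\<And>x g. x \<in> P \<Longrightarrow> g \<in> plucker_relations d N \<union> R_generators d N \<Longrightarrow> eval_poly x g = 0"
    unfolding zero_set_def by auto
  then obtain x where x: "x \<in> exterior_power d N" "x \<noteq> (\<lambda>_. 0)" and P: "P = scaling_rel d N `` {x}"
    unfolding proj_exterior_power_def quotient_def by blast
  have xP: "x \<in> P" unfolding P by (rule scaling_class_eq(2)[OF x(1), of 1]) (use x in auto)
  obtain S0 where "x S0 \<noteq> 0" using x by auto
  then have S0: "S0 \<in> basis_indices d N" "x S0 \<noteq> 0" using x unfolding exterior_power_def by auto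
  have plucker: "\<forall>g\<in>plucker_relations d N. eval_poly x g = 0"
    and line: "\<forall>g\<in>R_generators d N. eval_poly x g = 0" using zero xP by blast+
  obtain X b where X: "X \<in> carrier_mat d N" and tab: "is_tableau d N (\<lambda>i j. X $$ (i, j)) b"
    and wX: "\<And>S. S \<in> basis_indices d N \<Longrightarrow> wedge_rows d N X S = x S / x S0"
    using decomposable_if_exchange[OF plucker[unfolded eval_plucker_relations, rule_format] S0] by blast
  have w: "wedge_rows d N X = (\<lambda>S. (1 / x S0) * x S)"
  proof
    fix S show "wedge_rows d N X S = (1 / x S0) * x S"
      using wX[of S] x(1) by (cases "S \<in> basis_indices d N") (auto simp: wedge_rows_def exterior_power_def)
  qed
  have cls: "scaling_rel d N `` {wedge_rows d N X} = P" "wedge_rows d N X \<in> P"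
    unfolding P by (rule scaling_class_eq[OF x(1) _ w x(2)]; use S0 in simp)+
  have "wedge_rows d N X \<noteq> (\<lambda>_. 0)" using w S0 by (auto simp: fun_eq_iff)
  then have "P \<in> grassmannian d N" unfolding grassmannian_def using X cls(1) by blast
  moreover have "regular_matroid TYPE('u) N (column_matroid class_ring X)"
  proof (rule regular_if_no_four_point_line[OF X tab])
    fix B and p :: "nat \<Rightarrow> nat" assume B: "card B + 2 = d" "B \<subseteq> {..<N}"
      and p: "p ` {..<4} \<subseteq> {..<N} - B" "inj_on p {..<4}"
    have fin: "finite B" using B(2) by (rule finite_subset) simp
    let ?B = "sorted_list_of_set B" and ?p = "map p [0..<4]"
    have "distinct (?B @ ?p)" "set (?B @ ?p) \<subseteq> {..<N}" "length ?B + 2 = d" "length ?p = 4"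
      using fin B p by (auto simp: distinct_map atLeast0LessThan)
    then obtain i j where ij: "i < j" "j < 4" "x (set (?B @ [?p ! i, ?p ! j])) = 0"
      using line unfolding R_generators_zero_iff by blast
    moreover have "set (?B @ [?p ! i, ?p ! j]) = B \<union> {p i, p j}" using ij fin by simp
    ultimately have "wedge_rows d N X (B \<union> {p i, p j}) = 0" unfolding w by simp
    with ij show "\<exists>i j. i < j \<and> j < 4 \<and> wedge_rows d N X (B \<union> {p i, p j}) = 0" by blast
  qed
  ultimately show "P \<in> regular_grassmannian TYPE('u) d N"
    unfolding regular_grassmannian_def using X cls(2) by blast
qed

theorem proposition3p4:
  fixes d N :: nat
    and RGr :: "(nat set \<Rightarrow> 'a::field_char_0) set set"
  assumes "d \<le> N"
    and "infinite (UNIV :: 'u set)"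
    and "RGr = regular_grassmannian TYPE('u) d N"
  shows "projective_variety d N RGr
    \<and> RGr = zero_set d N (regular_grassmannian_ideal d N)
    \<and> (\<exists>Q M. Q \<subseteq> bracket_ring d N \<and> M \<subseteq> bracket_ring d N \<and>
          (\<forall>q\<in>Q. homogeneous 2 q) \<and> (\<forall>m\<in>M. is_monomial m \<and> homogeneous 6 m) \<and>
          regular_grassmannian_ideal d N = bracket_ideal d N (Q \<union> M) \<and>
          RGr = zero_set d N (Q \<union> M))"
proof -
  let ?Q = "plucker_relations d N :: 'a bracket_poly set"
  let ?G = "R_generators d N :: 'a bracket_poly set"
  \<comment> \<open>The generators of \<open>R_ideal\<close> carry the signs of the brackets; the set below contains the monomials
      without signs.\<close>
  let ?M = "{Poly_Mapping.single m 1 :: 'a bracket_poly | m. Poly_Mapping.single m 1 \<in> ?G \<or> - Poly_Mapping.single m 1 \<in> ?G}"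
  have M: "h \<in> ?G \<or> - h \<in> ?G" if "h \<in> ?M" for h using that by blast
  have "\<exists>h\<in>?Q \<union> ?M. g = h \<or> g = - h" if g: "g \<in> ?Q \<union> ?G" for g
  proof (cases "g \<in> ?Q")
    case False
    then have "g \<in> ?G" using g by blast
    moreover obtain m where m: "g = Poly_Mapping.single m 1 \<or> g = - Poly_Mapping.single m 1"
      using R_generator_signed_monomial[OF \<open>g \<in> ?G\<close>] by blast
    ultimately have "Poly_Mapping.single m 1 \<in> ?M" by auto
    with m show ?thesis by blast
  qed blast
  moreover have "\<exists>h\<in>?Q \<union> ?G. g = h \<or> g = - h" if g: "g \<in> ?Q \<union> ?M" for g
  proof (cases "g \<in> ?Q")
    case False
    then consider "g \<in> ?G" | "- g \<in> ?G" using g M by blast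
    then show ?thesis
    proof cases
      case 2
      then show ?thesis by (intro bexI[of _ "- g"]) simp_all
    qed blast
  qed blast
  ultimately have "bracket_ideal d N (?Q \<union> ?G) = bracket_ideal d N (?Q \<union> ?M)"
    by (intro equalityI bracket_ideal_cong_unit)
  then have ideal: "regular_grassmannian_ideal d N = bracket_ideal d N (?Q \<union> ?M)"
    unfolding regular_grassmannian_ideal_def plucker_ideal_def R_ideal_def bracket_ideal_Un .
  have RGr: "RGr = zero_set d N (regular_grassmannian_ideal d N)"
    using regular_grassmannian_subset_zero_set[OF assms(2), of d N, where 'a = 'a]
      zero_set_subset_regular_grassmannian[of d N, where 'a = 'a and 'u = 'u]
    unfolding assms(3) regular_grassmannian_ideal_def plucker_ideal_def R_ideal_def bracket_ideal_Un
      zero_set_bracket_ideal by (rule equalityI)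
  then have RGr': "RGr = zero_set d N (?Q \<union> ?M)" unfolding ideal zero_set_bracket_ideal .
  have Q: "?Q \<subseteq> bracket_ring d N" "\<forall>q\<in>?Q. homogeneous 2 q"
    using plucker_relation_in_bracket_ring plucker_relation_homogeneous by blast+
  have in_M: "h \<in> bracket_ring d N" "homogeneous 6 h" if "h \<in> ?M" for h :: "'a bracket_poly"
  proof -
    have "Poly_Mapping.keys (- h) = Poly_Mapping.keys h" by (auto simp: in_keys_iff)
    moreover have "h \<in> ?G \<or> - h \<in> ?G" using that by blast
    ultimately show "h \<in> bracket_ring d N" "homogeneous 6 h"
      using R_generator_in_bracket_ring[of h d N] R_generator_in_bracket_ring[of "- h" d N]
        R_generator_homogeneous[of h d N] R_generator_homogeneous[of "- h" d N]
      unfolding bracket_ring_def homogeneous_def by auto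
  qed
  have M': "?M \<subseteq> bracket_ring d N" by (rule subsetI) (rule in_M(1))
  have M6: "\<forall>m\<in>?M. homogeneous 6 m" by (rule ballI) (rule in_M(2))
  have mono: "\<forall>m\<in>?M. is_monomial m" unfolding is_monomial_def by blast
  have ring: "?Q \<union> ?M \<subseteq> bracket_ring d N" using Q(1) M' by (rule Un_least)
  have hom: "\<forall>g\<in>?Q \<union> ?M. \<exists>k. homogeneous k g" using Q(2) M6 by blast
  have "projective_variety d N RGr"
    unfolding projective_variety_def using ring hom RGr' by (intro exI[of _ "?Q \<union> ?M"] conjI)
  moreover have "\<exists>Q M. Q \<subseteq> bracket_ring d N \<and> M \<subseteq> bracket_ring d N \<and>
          (\<forall>q\<in>Q. homogeneous 2 q) \<and> (\<forall>m\<in>M. is_monomial m \<and> homogeneous 6 m) \<and>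
          regular_grassmannian_ideal d N = bracket_ideal d N (Q \<union> M) \<and>
          RGr = zero_set d N (Q \<union> M)"
  proof (rule exI[of _ ?Q], rule exI[of _ ?M], intro conjI)
    show "\<forall>m\<in>?M. is_monomial m \<and> homogeneous 6 m"
      by (intro ballI conjI) (erule mono[THEN bspec], erule M6[THEN bspec])
  qed (rule Q M' ideal RGr')+
  ultimately show ?thesis using RGr by (intro conjI)
qed

end
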